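(* Let $k$ be a positive integer and $\tau=2k$. If $n$ is sufficiently large and $\tau\mid n$, then every graph having the minimum spectral radius among all connected graphs on $n$ vertices with dissociation number $\tau$ also has the minimum number of edges among all connected graphs on $n$ vertices with dissociation number $\tau$.
   Context: The spectral radius is the largest eigenvalue of the adjacency matrix. The dissociation number of $G$ is the largest size of a vertex set inducing a subgraph of maximum degree at most $1$. *)

theory Defs
  imports
    Complex_Main
    "Graph_Theory.Graph_Theory"
    "Jordan_Normal_Form.Char_Poly"
begin

text \<open>
  Finite simple graphs are the locale \<open>pair_graph\<close> of the library: a finite vertex set \<open>pverts G\<close>
  with an irreflexive symmetric relation \<open>parcs G\<close>, so each undirected edge is a pair of opposite
  arcs. A graph on \<open>n\<close> vertices is taken, up to isomorphism, to have vertex set \<open>{0..<n}\<close>; the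
  vertices then directly index the rows and columns of the adjacency matrix.
\<close>

definition edge_set :: "'a pair_pre_digraph \<Rightarrow> 'a set set" where
  "edge_set G = {{u, v} | u v. (u, v) \<in> parcs G}"

definition num_edges :: "'a pair_pre_digraph \<Rightarrow> nat" where
  "num_edges G = card (edge_set G)"

definition adjacency_matrix :: "nat pair_pre_digraph \<Rightarrow> real mat" where
  "adjacency_matrix G =
     mat (card (pverts G)) (card (pverts G)) (\<lambda>(i, j). if (i, j) \<in> parcs G then 1 else 0)"

text \<open>
  The adjacency matrix is real symmetric, so its real eigenvalues are all its eigenvalues, and for
  \<open>n > 0\<close> they form a finite nonempty set.
\<close>

definition graph_spectral_radius :: "nat pair_pre_digraph \<Rightarrow> real" where
  "graph_spectral_radius G = Max {x. eigenvalue (adjacency_matrix G) x}"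

text \<open>
  In a symmetric digraph the out-degree of a vertex is its degree as a vertex of the undirected graph.
\<close>

definition dissociation_set :: "'a pair_pre_digraph \<Rightarrow> 'a set \<Rightarrow> bool" where
  "dissociation_set G S \<longleftrightarrow>
     S \<subseteq> pverts G \<and> (\<forall>v\<in>S. out_degree (induce_subgraph (with_proj G) S) v \<le> 1)"

definition dissociation_number :: "'a pair_pre_digraph \<Rightarrow> nat" where
  "dissociation_number G = Max (card ` {S. dissociation_set G S})"

definition connected_graphs_diss :: "nat \<Rightarrow> nat \<Rightarrow> nat pair_pre_digraph set" where
  "connected_graphs_diss n t =
     {G. pair_graph G \<and> pverts G = {0..<n} \<and> Digraph_Component.connected (with_proj G)
         \<and> dissociation_number G = t}"

end

theory Submission
  imports Defs "HOL-Library.Ramsey" "HOL-Analysis.Function_Topology" "HOL-Analysis.Convex"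
begin

text \<open>
  Write \<open>n = k m\<close> with \<open>m\<close> even, and count arcs, that is, twice the edges.

  Upper bound: take \<open>k\<close> complete graphs on \<open>m\<close> vertices, each without a perfect matching, joined
  along a path by single edges. A positive test vector shows that its spectral radius is less than
  \<open>m - 2 + 2 / m\<close>. The spectral radius is at least the average degree, so a minimizer has fewer
  than \<open>n (m - 2) + 2 k\<close> arcs.

  Lower bound: every connected graph with dissociation number \<open>2 k\<close> and \<open>n\<close> large has at least
  \<open>n (m - 2) + 2 (k - 1)\<close> arcs. Deleting vertices of large degree only helps, so assume that all
  degrees are at most \<open>(1 / k + \<epsilon>) n\<close>. An argument of Erdos-Stone type, with Ramsey's theorem inside
  the parts, yields \<open>k\<close> large cliques without edges between them. Every vertex is nearly complete to
  one of these, since otherwise two vertices from each clique extend it to a dissociation set of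
  size \<open>2 k + 1\<close>; this sorts the vertices into \<open>k\<close> classes, and the same extension argument shows
  that in each class the non-edges form a matching. Convexity bounds the arcs inside the classes, and
  connectedness forces \<open>k - 1\<close> edges between them. Arc counts are even, so the two bounds leave no gap.
\<close>

section \<open>Sparse sets and cliques without edges between them\<close>

text \<open>The value behind both bounds is n^2 / k - 2 n arcs: k equal classes in which every
  vertex misses exactly one classmate. Divisibility of n by 2 k makes the class size even, so that
  the missing edges can be perfect matchings. No structure of a spectral minimizer has to be
  determined: comparison with one test graph bounds its radius, and the average-degree inequality
  turns that into an arc count. The price is precision, since the window between the bounds is only
  two arcs wide; the upper bound has to be strict and the lower bound has no room for error terms.
  The obstacle in the lower bound is that the dissociation number does not cap degrees: a vertex
  adjacent to all others creates no larger dissociation set. The counting needs such a cap. If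
  degrees are at most (1 / k + \<epsilon>) n, then k cliques send out barely enough arcs for every
  vertex to be nearly complete to one of them, so few vertices can have many neighbours in a second
  one.\<close>

definition sgraph :: "('a \<Rightarrow> 'a \<Rightarrow> bool) \<Rightarrow> bool" where
  "sgraph E \<longleftrightarrow> symp E \<and> irreflp E"

lemma sgraph_sym: "sgraph E \<Longrightarrow> E u v \<longleftrightarrow> E v u"
  by (auto simp: sgraph_def dest: sympD)

lemma sgraph_irrefl [simp]: "sgraph E \<Longrightarrow> \<not> E v v"
  by (auto simp: sgraph_def dest: irreflpD)

text \<open>The relation and the vertex set are kept apart, so that deleting vertices or passing to
  a class changes only the set argument.\<close>

definition nbrs :: "('a \<Rightarrow> 'a \<Rightarrow> bool) \<Rightarrow> 'a set \<Rightarrow> 'a \<Rightarrow> 'a set" where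
  "nbrs E V v = {u \<in> V. E v u}"

definition sparse :: "('a \<Rightarrow> 'a \<Rightarrow> bool) \<Rightarrow> 'a set \<Rightarrow> bool" where
  "sparse E S \<longleftrightarrow> (\<forall>v\<in>S. card (nbrs E S v) \<le> 1)"

text \<open>An upper bound instead of the exact dissociation number, because it survives vertex
  deletion.\<close>

definition diss_le :: "('a \<Rightarrow> 'a \<Rightarrow> bool) \<Rightarrow> 'a set \<Rightarrow> nat \<Rightarrow> bool" where
  "diss_le E V d \<longleftrightarrow> (\<forall>S\<subseteq>V. sparse E S \<longrightarrow> card S \<le> d)"

lemma finite_nbrs [simp]: "finite V \<Longrightarrow> finite (nbrs E V v)"
  by (simp add: nbrs_def)

lemma nbrs_subset: "nbrs E V v \<subseteq> V"
  by (auto simp: nbrs_def)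

lemma diss_leD: "diss_le E V d \<Longrightarrow> S \<subseteq> V \<Longrightarrow> sparse E S \<Longrightarrow> card S \<le> d"
  by (auto simp: diss_le_def)

lemma diss_le_subset: "diss_le E V d \<Longrightarrow> U \<subseteq> V \<Longrightarrow> diss_le E U d"
  by (auto simp: diss_le_def)

lemma sum_card_nbrs_swap:
  assumes "sgraph E" "finite A" "finite B"
  shows "(\<Sum>v\<in>A. card (nbrs E B v)) = (\<Sum>q\<in>B. card (nbrs E A q))"
proof -
  have *: "card (nbrs E B v) = (\<Sum>q\<in>B. if E v q then 1 else 0)" if "finite B" for v B
    using that by (simp add: nbrs_def sum.If_cases Int_def)
  show ?thesis
    using assms by (simp add: * sum.swap[of _ B A] sgraph_sym[OF assms(1)])
qed

lemma sparse_Un: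
  assumes "sgraph E" "sparse E S" "sparse E P" "\<And>s p. s \<in> S \<Longrightarrow> p \<in> P \<Longrightarrow> \<not> E s p"
  shows "sparse E (S \<union> P)"
proof -
  have "nbrs E (S \<union> P) s = nbrs E S s" if "s \<in> S" for s
    using assms(4) that by (auto simp: nbrs_def)
  moreover have "nbrs E (S \<union> P) p = nbrs E P p" if "p \<in> P" for p
    using assms(4) that sgraph_sym[OF assms(1)] by (auto simp: nbrs_def)
  ultimately show ?thesis
    using assms(2,3) by (auto simp: sparse_def)
qed

lemma sparse_doubleton:
  assumes "sgraph E" shows "sparse E {x, y}"
proof -
  have "nbrs E {x, y} x \<subseteq> {y}" "nbrs E {x, y} y \<subseteq> {x}"
    using assms by (auto simp: nbrs_def)
  then show ?thesis
    by (auto simp: sparse_def dest!: card_mono[rotated])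
qed

text \<open>Only the edge between \<open>u\<close> and \<open>w\<close> can be present. Together
  with two vertices from each of \<open>k - 1\<close> further classes this seed would give a
  dissociation set of size \<open>2 * k + 1\<close>, which is what forces the non-edges of a class
  to form a matching.\<close>

lemma sparse_cherry:
  assumes "sgraph E" "\<not> E v u" "\<not> E v w" shows "sparse E {v, u, w}"
proof -
  have "sparse E ({v} \<union> {u, w})"
    using assms sparse_doubleton[OF assms(1), of v v]
    by (intro sparse_Un sparse_doubleton) auto
  then show ?thesis by (simp add: insert_commute)
qed

section \<open>Greedy extension of dissociation sets\<close>

lemma two_elements: "card X \<ge> 2 \<Longrightarrow> \<exists>x\<in>X. \<exists>y\<in>X. x \<noteq> y"
  using card_le_Suc0_iff_eq[of X] card.infinite[of X] by force

text \<open>The at most \<open>2 * K\<close> vertices chosen so far exclude at most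
  \<open>2 * g * K\<close> vertices of the next set, so two remain, and only the edge between these
  two can be added. The bound \<open>K\<close> is separate from \<open>card J\<close> so that the
  size condition stays fixed during the induction.\<close>

lemma greedy_pairs:
  assumes E: "sgraph E" and J: "finite J" and K: "card J \<le> K"
    and A: "\<And>j. j \<in> J \<Longrightarrow> finite (A j)" "\<And>j. j \<in> J \<Longrightarrow> card (A j) \<ge> 2 * g * K + 2"
    and disj: "\<And>i j. i \<in> J \<Longrightarrow> j \<in> J \<Longrightarrow> i \<noteq> j \<Longrightarrow> A i \<inter> A j = {}"
    and g: "\<And>i j v. i \<in> J \<Longrightarrow> j \<in> J \<Longrightarrow> i \<noteq> j \<Longrightarrow> v \<in> A i \<Longrightarrow> card (nbrs E (A j) v) \<le> g"
  shows "\<exists>P \<subseteq> (\<Union>j\<in>J. A j). card P = 2 * card J \<and> sparse E P"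
  using J K A disj g
proof (induction J rule: finite_induct)
  case empty
  show ?case by (auto simp: sparse_def)
next
  case (insert j J)
  have "\<exists>P \<subseteq> (\<Union>j\<in>J. A j). card P = 2 * card J \<and> sparse E P"
  proof (rule insert.IH)
    show "card (nbrs E (A j') v) \<le> g" if "i \<in> J" "j' \<in> J" "i \<noteq> j'" "v \<in> A i" for i j' v
      using insert.prems(5) that by blast
    show "card J \<le> K" using insert.prems(1) insert.hyps by simp
    show "finite (A i)" "2 * g * K + 2 \<le> card (A i)" if "i \<in> J" for i
      using insert.prems(2,3)[of i] that by simp_all
    show "A i \<inter> A j' = {}" if "i \<in> J" "j' \<in> J" "i \<noteq> j'" for i j'
      using insert.prems(4)[of i j'] that by simp
  qed
  then obtain P where P: "P \<subseteq> (\<Union>j\<in>J. A j)" "card P = 2 * card J" "sparse E P" by blast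
  have finP: "finite P"
    using P(1) insert.hyps insert.prems(2) by (meson finite_UN_I finite_subset insertI2)
  define B where "B = (\<Union>p\<in>P. nbrs E (A j) p)"
  have "card (nbrs E (A j) p) \<le> g" if "p \<in> P" for p
    using P(1) that insert.hyps insert.prems(5) by blast
  then have "(\<Sum>p\<in>P. card (nbrs E (A j) p)) \<le> card P * g"
    using sum_bounded_above[of P "\<lambda>p. card (nbrs E (A j) p)" g] by simp
  with card_UN_le[OF finP] have "card B \<le> card P * g"
    unfolding B_def by (rule le_trans)
  also have "\<dots> \<le> 2 * K * g"
    using P(2) insert.prems(1) insert.hyps by (intro mult_right_mono) auto
  finally have "card B \<le> 2 * g * K" by (simp add: algebra_simps)
  moreover have "finite B" "B \<subseteq> A j"
    using finP insert.prems(2) by (auto simp: B_def nbrs_def)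
  ultimately have "card (A j - B) \<ge> 2"
    using insert.prems(3)[of j] by (simp add: card_Diff_subset)
  then obtain x y where xy: "x \<in> A j - B" "y \<in> A j - B" "x \<noteq> y"
    using two_elements by blast
  have nadj: "\<not> E p z" if "p \<in> P" "z \<in> {x, y}" for p z
    using that xy by (auto simp: B_def nbrs_def)
  have "sparse E (P \<union> {x, y})"
    using P(3) nadj by (intro sparse_Un sparse_doubleton E) auto
  moreover have "P \<inter> {x, y} = {}"
    using P(1) xy insert.hyps insert.prems(4) by blast
  then have "card (P \<union> {x, y}) = 2 * card (insert j J)"
    using finP insert.hyps xy(3) P(2) by (subst card_Un_disjoint) auto
  moreover have "P \<union> {x, y} \<subseteq> (\<Union>j\<in>insert j J. A j)"
    using P(1) xy by auto
  ultimately show ?case by blast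
qed

text \<open>The form in which every extension argument is run. The seed \<open>S\<close> is either
  one vertex against \<open>k\<close> sets or a cherry against \<open>k - 1\<close> sets; both give
  the impossible total \<open>2 * k + 1\<close>.\<close>

lemma greedy_pairs_diss:
  assumes E: "sgraph E" and J: "finite J" and K: "card J \<le> K" and V: "diss_le E V d" "finite V"
    and A: "\<And>j. j \<in> J \<Longrightarrow> A j \<subseteq> V" "\<And>j. j \<in> J \<Longrightarrow> card (A j) \<ge> 2 * g * K + 2"
    and disj: "\<And>i j. i \<in> J \<Longrightarrow> j \<in> J \<Longrightarrow> i \<noteq> j \<Longrightarrow> A i \<inter> A j = {}"
    and g: "\<And>i j v. i \<in> J \<Longrightarrow> j \<in> J \<Longrightarrow> i \<noteq> j \<Longrightarrow> v \<in> A i \<Longrightarrow> card (nbrs E (A j) v) \<le> g"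
    and S: "S \<subseteq> V" "sparse E S"
      "\<And>j s x. j \<in> J \<Longrightarrow> s \<in> S \<Longrightarrow> x \<in> A j \<Longrightarrow> x \<noteq> s \<and> \<not> E s x"
  shows "card S + 2 * card J \<le> d"
proof -
  have "\<exists>P \<subseteq> (\<Union>j\<in>J. A j). card P = 2 * card J \<and> sparse E P"
    by (rule greedy_pairs[OF E J K finite_subset[OF A(1) V(2)] A(2) disj g])
  then obtain P where P: "P \<subseteq> (\<Union>j\<in>J. A j)" "card P = 2 * card J" "sparse E P" by blast
  have "sparse E (S \<union> P)"
    using S P by (intro sparse_Un E) blast+
  moreover have "S \<union> P \<subseteq> V" using S(1) P(1) A(1) by blast
  ultimately have "card (S \<union> P) \<le> d" using V(1) diss_leD by blast
  moreover have "S \<inter> P = {}" using S(3) P(1) by blast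
  then have "card (S \<union> P) = card S + card P"
    using \<open>S \<union> P \<subseteq> V\<close> V(2) by (meson card_Un_disjoint finite_Un finite_subset)
  ultimately show ?thesis using P(2) by simp
qed

text \<open>Ramsey's theorem: the alternative to the clique is an independent set of size
  \<open>Suc d\<close>, a dissociation set that is too large.\<close>

lemma large_clique:
  "\<exists>R. \<forall>(V::'a set) E. sgraph E \<longrightarrow> finite V \<longrightarrow> diss_le E V d \<longrightarrow> card V \<ge> R \<longrightarrow>
    (\<exists>C\<subseteq>V. card C = t \<and> (\<forall>u\<in>C. \<forall>v\<in>C. u \<noteq> v \<longrightarrow> E u v))"
proof -
  obtain R where R: "\<And>(V::'a set) (F::'a set set). finite V \<Longrightarrow> card V \<ge> R \<Longrightarrow>
    \<exists>C \<subseteq> V. card C = t \<and> clique C F \<or> card C = Suc d \<and> indep C F"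
    using ramsey2[of t "Suc d"] by metis
  show ?thesis
  proof (intro exI[of _ R] allI impI)
    fix V :: "'a set" and E assume E: "sgraph E" and V: "finite V" "diss_le E V d" "R \<le> card V"
    define F where "F = {{u, v} | u v. E u v}"
    have F: "{u, v} \<in> F \<longleftrightarrow> E u v" for u v
      using sgraph_sym[OF E] by (auto simp: F_def doubleton_eq_iff)
    obtain C where C: "C \<subseteq> V" "card C = t \<and> clique C F \<or> card C = Suc d \<and> indep C F"
      using R[OF V(1,3)] by blast
    have "\<not> (card C = Suc d \<and> indep C F)"
    proof
      assume *: "card C = Suc d \<and> indep C F"
      then have "nbrs E C v = {}" if "v \<in> C" for v
        using that E F by (auto simp: nbrs_def indep_def) (metis sgraph_irrefl)
      then have "sparse E C" by (simp add: sparse_def)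
      then show False using diss_leD[OF V(2) C(1)] * by simp
    qed
    then show "\<exists>C\<subseteq>V. card C = t \<and> (\<forall>u\<in>C. \<forall>v\<in>C. u \<noteq> v \<longrightarrow> E u v)"
      using C by (auto simp: clique_def F)
  qed
qed

section \<open>Mutually non-adjacent cliques\<close>

definition clique_family :: "('a \<Rightarrow> 'a \<Rightarrow> bool) \<Rightarrow> 'a set \<Rightarrow> nat \<Rightarrow> nat \<Rightarrow> (nat \<Rightarrow> 'a set) \<Rightarrow> bool" where
  "clique_family E V r t Q \<longleftrightarrow>
     (\<forall>i<r. Q i \<subseteq> V \<and> card (Q i) = t \<and> (\<forall>u\<in>Q i. \<forall>v\<in>Q i. u \<noteq> v \<longrightarrow> E u v)) \<and>
     (\<forall>i<r. \<forall>j<r. i \<noteq> j \<longrightarrow> Q i \<inter> Q j = {} \<and> (\<forall>u\<in>Q i. \<forall>v\<in>Q j. \<not> E u v))"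

lemma clique_familyD:
  assumes "clique_family E V r t Q" "i < r"
  shows "Q i \<subseteq> V" "card (Q i) = t" "\<And>u v. u \<in> Q i \<Longrightarrow> v \<in> Q i \<Longrightarrow> u \<noteq> v \<Longrightarrow> E u v"
    "\<And>j. j < r \<Longrightarrow> i \<noteq> j \<Longrightarrow> Q i \<inter> Q j = {}"
    "\<And>j u v. j < r \<Longrightarrow> i \<noteq> j \<Longrightarrow> u \<in> Q i \<Longrightarrow> v \<in> Q j \<Longrightarrow> \<not> E u v"
  using assms unfolding clique_family_def by blast+

lemma large_fibre:
  assumes "finite A" "f ` A \<subseteq> B" "finite B" "card A > card B * R"
  shows "\<exists>y. card {x \<in> A. f x = y} \<ge> R"
proof (rule ccontr)
  assume "\<not> ?thesis"
  then have *: "card {x \<in> A. f x = y} \<le> R" for y by (meson nat_le_linear)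
  have "card A = (\<Sum>y\<in>f ` A. card {x \<in> A. f x = y})"
    using sum.image_gen[OF assms(1), of "\<lambda>_. 1::nat" f] by simp
  also have "\<dots> \<le> card (f ` A) * R"
    using sum_bounded_above[of "f ` A" "\<lambda>y. card {x \<in> A. f x = y}" R] * by simp
  also have "\<dots> \<le> card B * R"
    using assms by (intro mult_right_mono card_mono) auto
  finally show False using assms(4) by simp
qed

lemma card_disjoint_family:
  assumes "clique_family E V r t Q" "finite V"
  shows "card (\<Union>i<r. Q i) = r * t" "finite (\<Union>i<r. Q i)" "(\<Union>i<r. Q i) \<subseteq> V"
proof -
  have fin: "finite (Q i)" if "i < r" for i
    using clique_familyD(1)[OF assms(1) that] assms(2) finite_subset by blast
  then show "finite (\<Union>i<r. Q i)" by blast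
  have "card (\<Union>i<r. Q i) = (\<Sum>i<r. card (Q i))"
    using fin clique_familyD(4)[OF assms(1)] by (intro card_UN_disjoint) auto
  then show "card (\<Union>i<r. Q i) = r * t"
    using clique_familyD(2)[OF assms(1)] by simp
  show "(\<Union>i<r. Q i) \<subseteq> V" using clique_familyD(1)[OF assms(1)] by blast
qed

text \<open>Induction on the number of cliques, for all \<open>t\<close> at once because each step
  shrinks the old cliques. The hypothesis says \<open>(k - 1) * c < 1\<close>: fewer than
  \<open>k\<close> cliques send out too few arcs to be almost complete to all vertices, so a
  positive proportion of the vertices has many non-neighbours in every old clique. Among those with
  the same trace on the old cliques, Ramsey's theorem finds the new clique, and a common trace means
  common non-neighbours.\<close>

lemma exists_clique_family:
  fixes c :: real
  assumes "real k * c < 1 + c" "c \<ge> 0" "r \<le> k"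
  shows "\<exists>N. \<forall>(V::'a set) E. sgraph E \<longrightarrow> finite V \<longrightarrow> diss_le E V d \<longrightarrow> card V \<ge> N \<longrightarrow>
    (\<forall>v\<in>V. real (card (nbrs E V v)) \<le> c * card V) \<longrightarrow> (\<exists>Q. clique_family E V r t Q)"
  using assms(3)
proof (induction r arbitrary: t)
  case 0
  show ?case by (auto simp: clique_family_def)
next
  case (Suc r)
  \<comment> \<open>Half of the room left by \<open>r * c < 1\<close>, so that
    \<open>r * c = 1 - 2 * \<eta>\<close>. With \<open>\<eta> * T \<ge> t + 1\<close> this yields
    \<open>(1 - 2 * \<eta>) * T \<le> (1 - \<eta>) * (T - t - 1)\<close>, the inequality that bounds
    \<open>U\<close>.\<close>
  define \<eta> where "\<eta> = (1 - r * c) / 2"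
  have "real r * c \<le> (real k - 1) * c"
    using Suc.prems assms(2) by (intro mult_right_mono) auto
  then have rc: "real r * c < 1" using assms(1) by (simp add: algebra_simps)
  have \<eta>: "\<eta> > 0" "\<eta> \<le> 1 / 2" using rc assms(2) by (auto simp: \<eta>_def)
  define T where "T = nat \<lceil>(real t + 1) / \<eta>\<rceil>"
  have T: "\<eta> * T \<ge> real t + 1"
  proof -
    have "(real t + 1) / \<eta> \<le> T" unfolding T_def by (rule real_nat_ceiling_ge)
    then show ?thesis using \<eta> by (simp add: field_simps)
  qed
  have "\<eta> * T \<le> 1 / 2 * T" using \<eta> by (intro mult_right_mono) auto
  then have tT: "real T \<ge> 2 * (real t + 1)" using T by simp
  obtain N where N: "\<And>(V::'a set) E. sgraph E \<Longrightarrow> finite V \<Longrightarrow> diss_le E V d \<Longrightarrow> card V \<ge> N \<Longrightarrow>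
    (\<forall>v\<in>V. real (card (nbrs E V v)) \<le> c * card V) \<Longrightarrow> \<exists>Q. clique_family E V r T Q"
    using Suc.IH[of T] Suc.prems by (metis Suc_leD)
  obtain R where R: "\<And>(V::'a set) E. sgraph E \<Longrightarrow> finite V \<Longrightarrow> diss_le E V d \<Longrightarrow> card V \<ge> R \<Longrightarrow>
    \<exists>C\<subseteq>V. card C = t \<and> (\<forall>u\<in>C. \<forall>v\<in>C. u \<noteq> v \<longrightarrow> E u v)"
    using large_clique[of d t] by metis
  define M where "M = nat \<lceil>(2 ^ (r * T) * R + 1) / \<eta>\<rceil>"
  show ?case
  proof (intro exI[of _ "max N M"] allI impI)
    fix V :: "'a set" and E
    assume E: "sgraph E" and V: "finite V" "diss_le E V d" "max N M \<le> card V"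
      and deg: "\<forall>v\<in>V. real (card (nbrs E V v)) \<le> c * real (card V)"
    obtain Q where Q: "clique_family E V r T Q" using N[OF E V(1,2)] V(3) deg by auto
    note QD = clique_familyD[OF Q]
    define QQ where "QQ = (\<Union>i<r. Q i)"
    note QQ = card_disjoint_family[OF Q V(1), folded QQ_def]
    have finQ: "finite (Q i)" if "i < r" for i
      using QD(1)[OF that] V(1) finite_subset by blast
    \<comment> \<open>A vertex outside \<open>U\<close> has more than \<open>t\<close>
      non-neighbours in every clique. Vertices of the cliques miss only themselves there and so fall
      into \<open>U\<close>, which keeps the new clique disjoint from the old ones.\<close>
    define U where "U = {v \<in> V. \<exists>i<r. card (Q i - nbrs E (Q i) v) \<le> t + 1}"
    have finU: "finite U" "U \<subseteq> V" using V(1) by (auto simp: U_def)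
    have U: "real T - t - 1 \<le> card (nbrs E QQ v)" if "v \<in> U" for v
    proof -
      obtain i where i: "i < r" "card (Q i - nbrs E (Q i) v) \<le> t + 1"
        using \<open>v \<in> U\<close> unfolding U_def by blast
      have "card (Q i - nbrs E (Q i) v) = T - card (nbrs E (Q i) v)"
        using QD(2)[OF i(1)] finQ[OF i(1)] nbrs_subset[of E "Q i" v]
        by (simp add: card_Diff_subset)
      moreover have "card (nbrs E (Q i) v) \<le> card (nbrs E QQ v)"
        using i(1) QQ(2) by (intro card_mono finite_nbrs) (auto simp: nbrs_def QQ_def)
      ultimately show ?thesis using i(2) by linarith
    qed
    \<comment> \<open>The arcs between the cliques and \<open>U\<close> are counted from both ends:
      a vertex of \<open>U\<close> receives at least \<open>T - t - 1\<close>, a clique vertex sends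
      at most \<open>c * card V\<close>.\<close>
    have "card U * (real T - t - 1) \<le> (\<Sum>v\<in>U. real (card (nbrs E QQ v)))"
      using sum_bounded_below[of U "real T - t - 1" "\<lambda>v. real (card (nbrs E QQ v))"] U by simp
    also have "\<dots> \<le> (\<Sum>v\<in>V. real (card (nbrs E QQ v)))"
      using V(1) finU by (intro sum_mono2) auto
    also have "\<dots> = (\<Sum>q\<in>QQ. real (card (nbrs E V q)))"
      using sum_card_nbrs_swap[OF E V(1) QQ(2)] by (metis of_nat_sum)
    also have "\<dots> \<le> card QQ * (c * card V)"
      using deg QQ(3) by (intro sum_bounded_above) auto
    also have "\<dots> = (r * c) * T * card V" using QQ(1) by simp
    also have "\<dots> \<le> ((1 - \<eta>) * (real T - t - 1)) * card V"
    proof (intro mult_right_mono)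
      have rc': "r * c = 1 - 2 * \<eta>" by (simp add: \<eta>_def field_simps)
      have "\<eta> * (t + 1) \<ge> 0" using \<eta> by simp
      then show "(r * c) * T \<le> (1 - \<eta>) * (real T - t - 1)"
        unfolding rc' using T by (simp add: algebra_simps)
    qed simp
    finally have "real (card U) * (real T - t - 1) \<le> ((1 - \<eta>) * card V) * (real T - t - 1)"
      by (simp add: algebra_simps)
    then have cU: "card U \<le> (1 - \<eta>) * card V"
      using tT by (simp add: mult_le_cancel_right)
    have "real (card (V - U)) = real (card V) - card U"
      using finU V(1) by (simp add: card_Diff_subset card_mono)
    then have "real (card (V - U)) \<ge> \<eta> * card V" using cU by (simp add: algebra_simps)
    moreover have "\<eta> * card V \<ge> 2 ^ (r * T) * R + 1"
    proof -
      have "(2 ^ (r * T) * R + 1) / \<eta> \<le> M" unfolding M_def by (rule real_nat_ceiling_ge)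
      also have "\<dots> \<le> card V" using V(3) by simp
      finally show ?thesis using \<eta> by (simp add: field_simps)
    qed
    ultimately have "real (card (V - U)) > real (2 ^ (r * T) * R)" by simp
    then have "card (V - U) > card (Pow QQ) * R"
      using QQ by (simp only: of_nat_less_iff card_Pow)
    then obtain Y where Y: "card {x \<in> V - U. nbrs E QQ x = Y} \<ge> R"
      using large_fibre[of "V - U" "nbrs E QQ" "Pow QQ" R] V(1) QQ(2) nbrs_subset[of E QQ] by blast
    define F where "F = {x \<in> V - U. nbrs E QQ x = Y}"
    have F: "finite F" "F \<subseteq> V" using V(1) by (auto simp: F_def)
    obtain C where C: "C \<subseteq> F" "card C = t" "\<forall>u\<in>C. \<forall>v\<in>C. u \<noteq> v \<longrightarrow> E u v"
      using R[OF E F(1) diss_le_subset[OF V(2) F(2)]] Y by (auto simp: F_def)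
    have "\<exists>Q'. \<forall>i<r. Q' i \<subseteq> Q i \<and> card (Q' i) = t \<and> (\<forall>u\<in>C. \<forall>v\<in>Q' i. \<not> E u v \<and> u \<noteq> v)"
    \<comment> \<open>The common trace \<open>Y\<close> is read off from a vertex of
      \<open>C\<close>; an empty \<open>C\<close> means \<open>t = 0\<close>.\<close>
    proof (cases "C = {}")
      case True
      then have "t = 0" using C by simp
      then show ?thesis using True by (intro exI[of _ "\<lambda>_. {}"]) auto
    next
      case False
      then obtain x where x: "x \<in> C" by blast
      have "\<exists>P. P \<subseteq> Q i - Y \<and> card P = t" if "i < r" for i
      proof -
        have "Q i - nbrs E (Q i) x = Q i - Y"
          using x C(1) that by (auto simp: F_def nbrs_def QQ_def)
        moreover have "x \<in> V" "x \<notin> U" using x C(1) by (auto simp: F_def)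
        then have "\<not> card (Q i - nbrs E (Q i) x) \<le> t + 1" using that unfolding U_def by blast
        ultimately have "card (Q i - Y) \<ge> t" by simp
        then show ?thesis by (meson obtain_subset_with_card_n)
      qed
      then obtain Q' where Q': "\<And>i. i < r \<Longrightarrow> Q' i \<subseteq> Q i - Y \<and> card (Q' i) = t" by metis
      have "\<not> E u v \<and> u \<noteq> v" if "i < r" "u \<in> C" "v \<in> Q' i" for i u v
      proof -
        have "nbrs E QQ u = Y" "v \<in> Q i" "v \<notin> Y" using Q' that C(1) by (auto simp: F_def)
        then have "\<not> E u v" using that(1) by (auto simp: nbrs_def QQ_def)
        moreover have "u \<notin> Q i"
        proof
          assume "u \<in> Q i"
          then have "Q i - nbrs E (Q i) u \<subseteq> {u}"
            using QD(3)[OF that(1), of u] by (auto simp: nbrs_def)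
          then have "card (Q i - nbrs E (Q i) u) \<le> t + 1" by (auto dest!: card_mono[rotated])
          moreover have "u \<in> V" "u \<notin> U" using that(2) C(1) by (auto simp: F_def)
          ultimately show False using that(1) unfolding U_def by blast
        qed
        ultimately show ?thesis using \<open>v \<in> Q i\<close> by auto
      qed
      then show ?thesis using Q' by (intro exI[of _ Q']) blast
    qed
    then obtain Q' where Q': "\<And>i. i < r \<Longrightarrow> Q' i \<subseteq> Q i" "\<And>i. i < r \<Longrightarrow> card (Q' i) = t"
      "\<And>i u v. i < r \<Longrightarrow> u \<in> C \<Longrightarrow> v \<in> Q' i \<Longrightarrow> \<not> E u v \<and> u \<noteq> v" by metis
    have "clique_family E V (Suc r) t (Q'(r := C))"
      unfolding clique_family_def
    proof (intro conjI allI impI)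
      fix i assume i: "i < Suc r"
      have low: "Q' i \<subseteq> Q i" "Q i \<subseteq> V" if "i \<noteq> r" using i that Q'(1) QD(1) by simp_all
      show "(Q'(r := C)) i \<subseteq> V" using low C(1) F(2) by (cases "i = r") auto
      show "card ((Q'(r := C)) i) = t" using i Q'(2) C(2) by auto
      show "\<forall>u\<in>(Q'(r := C)) i. \<forall>v\<in>(Q'(r := C)) i. u \<noteq> v \<longrightarrow> E u v"
      proof (cases "i = r")
        case False
        then have "i < r" using i by simp
        then show ?thesis using low QD(3)[of i] False by (auto 0 3 simp: subset_iff)
      qed (use C(3) in auto)
      fix j assume j: "j < Suc r" "i \<noteq> j"
      consider "i = r" "j < r" | "j = r" "i < r" | "i < r" "j < r" using i j by linarith
      then have "(Q'(r := C)) i \<inter> (Q'(r := C)) j = {} \<and>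
        (\<forall>u\<in>(Q'(r := C)) i. \<forall>v\<in>(Q'(r := C)) j. \<not> E u v)"
      proof cases
        case 1 then show ?thesis using Q'(3) by auto
      next
        case 2
        then show ?thesis using Q'(3)[of i] sgraph_sym[OF E] by auto
      next
        case 3
        then show ?thesis using Q'(1)[of i] Q'(1)[of j] QD(4)[of i j] QD(5)[of i j] j by (auto 0 3)
      qed
      then show "(Q'(r := C)) i \<inter> (Q'(r := C)) j = {}"
        "\<forall>u\<in>(Q'(r := C)) i. \<forall>v\<in>(Q'(r := C)) j. \<not> E u v" by blast+
    qed
    then show "\<exists>Q. clique_family E V (Suc r) t Q" by blast
  qed
qed

text \<open>Since \<open>v\<close> is among its own non-neighbours, the bound 2 allows one missing
  classmate: the non-edges of each class form a matching. Classes may be empty; that all are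
  inhabited is stated separately where crossing edges are counted.\<close>

definition near_clique_partition ::
  "('a \<Rightarrow> 'a \<Rightarrow> bool) \<Rightarrow> 'a set \<Rightarrow> nat \<Rightarrow> ('a \<Rightarrow> nat) \<Rightarrow> bool" where
  "near_clique_partition E V k f \<longleftrightarrow>
     (\<forall>v\<in>V. f v < k \<and> card ({u \<in> V. f u = f v} - nbrs E V v) \<le> 2)"

lemma near_clique_partitionI:
  assumes "sgraph E" "finite V" "\<And>v. v \<in> V \<Longrightarrow> f v < k"
    and "\<And>v u w. v \<in> V \<Longrightarrow> u \<in> V \<Longrightarrow> w \<in> V \<Longrightarrow> f u = f v \<Longrightarrow> f w = f v \<Longrightarrow>
      v \<noteq> u \<Longrightarrow> v \<noteq> w \<Longrightarrow> u \<noteq> w \<Longrightarrow> \<not> E v u \<Longrightarrow> \<not> E v w \<Longrightarrow> False"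
  shows "near_clique_partition E V k f"
  unfolding near_clique_partition_def
proof (intro ballI conjI)
  fix v assume v: "v \<in> V"
  then show "f v < k" using assms(3) by blast
  define X where "X = {u \<in> V. f u = f v} - nbrs E V v"
  have X: "v \<in> X" "finite X" using v assms(1,2) by (auto simp: X_def nbrs_def)
  have "card (X - {v}) \<le> 1"
  proof (rule ccontr)
    assume "\<not> ?thesis"
    then obtain u w where "u \<in> X - {v}" "w \<in> X - {v}" "u \<noteq> w"
      by (metis One_nat_def X(2) card_le_Suc0_iff_eq finite_Diff)
    then show False using assms(4)[of v u w] v by (auto simp: X_def nbrs_def)
  qed
  then show "card ({u \<in> V. f u = f v} - nbrs E V v) \<le> 2"
    unfolding X_def[symmetric] using X by (simp add: card_Diff_singleton)
qed

lemma near_clique_partition_nbrs: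
  assumes "near_clique_partition E V k f" "finite V" "v \<in> V"
  shows "card {u \<in> V. f u = f v} \<le> card (nbrs E {u \<in> V. f u = f v} v) + 2"
proof -
  define X where "X = {u \<in> V. f u = f v}"
  have "X - nbrs E V v = X - nbrs E X v" by (auto simp: X_def nbrs_def)
  then have "card (X - nbrs E X v) \<le> 2"
    using assms(1,3) unfolding near_clique_partition_def X_def by auto
  moreover have "finite X" using assms(2) by (simp add: X_def)
  ultimately show ?thesis
    unfolding X_def[symmetric] using card_Diff_subset[of "nbrs E X v" X] nbrs_subset[of E X v]
    by simp
qed

lemma sum_card_classes:
  assumes "finite V" "\<And>v. v \<in> V \<Longrightarrow> f v < (k::nat)"
  shows "(\<Sum>i<k. card {u \<in> V. f u = i}) = card V"
proof -
  have "V = (\<Union>i<k. {u \<in> V. f u = i})" using assms(2) by auto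
  then have "card V = card (\<Union>i<k. {u \<in> V. f u = i})" by simp
  also have "\<dots> = (\<Sum>i<k. card {u \<in> V. f u = i})"
    using assms(1) by (intro card_UN_disjoint) auto
  finally show ?thesis by simp
qed

text \<open>Each vertex is adjacent to all but at most two vertices of its class, itself included,
  so the degree bound caps the class size. The lower bound is what \<open>k - 1\<close> classes of
  maximal size leave over.\<close>

lemma near_clique_partition_class_bounds:
  fixes D :: real
  assumes "near_clique_partition E V k f" "finite V" "D \<ge> 0"
    and deg: "\<And>v. v \<in> V \<Longrightarrow> real (card (nbrs E V v)) \<le> D" and "i < k"
  shows "card {u \<in> V. f u = i} \<le> D + 2"
    and "card {u \<in> V. f u = i} \<ge> card V - (real k - 1) * (D + 2)"
proof -
  have ub: "card {u \<in> V. f u = i} \<le> D + 2" for i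
  proof (cases "{u \<in> V. f u = i} = {}")
    case False
    then obtain v where v: "v \<in> V" "f v = i" by auto
    have "card (nbrs E {u \<in> V. f u = f v} v) \<le> card (nbrs E V v)"
      using assms(2) by (intro card_mono) (auto simp: nbrs_def)
    with near_clique_partition_nbrs[OF assms(1,2) v(1)] deg[OF v(1)] v(2)
    show ?thesis by simp
  next
    case True
    then show ?thesis using assms(3) by (simp only: card.empty)
  qed
  then show "card {u \<in> V. f u = i} \<le> D + 2" .
  have "real (card V) = (\<Sum>i<k. real (card {u \<in> V. f u = i}))"
    using sum_card_classes[OF assms(2), of f k] assms(1)
    by (metis near_clique_partition_def of_nat_sum)
  also have "\<dots> = card {u \<in> V. f u = i} + (\<Sum>j\<in>{..<k} - {i}. real (card {u \<in> V. f u = j}))"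
    using assms(5) by (simp add: sum.remove)
  also have "(\<Sum>j\<in>{..<k} - {i}. real (card {u \<in> V. f u = j})) \<le> real (card ({..<k} - {i})) * (D + 2)"
    using ub by (intro sum_bounded_above) auto
  also have "real (card ({..<k} - {i})) = real k - 1"
    using assms(5) by simp
  finally show "card {u \<in> V. f u = i} \<ge> card V - (real k - 1) * (D + 2)" by simp
qed

lemma clique_family_near_complete:
  assumes E: "sgraph E" and V: "finite V" "diss_le E V (2 * k)"
    and Q: "clique_family E V k t Q" and v: "v \<in> V"
  shows "\<exists>i<k. card (Q i - nbrs E (Q i) v) \<le> 1"
proof (rule ccontr)
  assume *: "\<not> ?thesis"
  define A where "A i = Q i - nbrs E (Q i) v" for i
  note QD = clique_familyD[OF Q]
  have A2: "card (A i) \<ge> 2" if "i < k" for i using * that by (force simp: A_def)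
  have vQ: "v \<notin> Q i" if "i < k" for i
  proof
    assume "v \<in> Q i"
    then have "A i \<subseteq> {v}" using QD(3)[OF that, of v] by (auto simp: A_def nbrs_def)
    then have "card (A i) \<le> 1" by (auto dest!: card_mono[rotated])
    then show False using A2[OF that] by simp
  qed
  have "card {v} + 2 * card {..<k} \<le> 2 * k"
  proof (rule greedy_pairs_diss[where A = A and g = 0 and K = k, OF E _ _ V(2,1)])
    show "card (nbrs E (A j) u) \<le> 0" if "i \<in> {..<k}" "j \<in> {..<k}" "i \<noteq> j" "u \<in> A i" for i j u
    proof -
      have "nbrs E (A j) u = {}" using QD(5)[of i j u] that by (auto simp: A_def nbrs_def)
      then show ?thesis by simp
    qed
    show "sparse E {v}" using sparse_doubleton[OF E, of v v] by simp
    show "2 * 0 * k + 2 \<le> card (A j)" if "j \<in> {..<k}" for j using A2[of j] that by simp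
    show "A i \<inter> A j = {}" if "i \<in> {..<k}" "j \<in> {..<k}" "i \<noteq> j" for i j
      using QD(4)[of i j] that by (auto simp: A_def)
    show "x \<noteq> s \<and> \<not> E s x" if "j \<in> {..<k}" "s \<in> {v}" "x \<in> A j" for j s x
      using vQ[of j] that by (auto simp: A_def nbrs_def)
    show "A j \<subseteq> V" if "j \<in> {..<k}" for j using QD(1)[of j] that by (auto simp: A_def)
  qed (use v in auto)
  then show False by simp
qed

text \<open>
  The discarded vertices have many neighbours in two of the cliques. Counting the arcs that leave the
  cliques shows that they are few, since the degrees barely allow one clique per vertex.
\<close>

lemma typical_vertices:
  fixes D :: real
  assumes E: "sgraph E" and V: "finite V" "diss_le E V (2 * k)"
    and Q: "clique_family E V k (4 * t) Q" and t: "t > 0"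
    and deg: "\<And>v. v \<in> V \<Longrightarrow> real (card (nbrs E V v)) \<le> D"
    and D: "real k * 4 * t * D \<le> (4 * t + 1) * card V"
  obtains V' f where "V' \<subseteq> V" "t * real (card (V - V')) \<le> 2 * card V" "near_clique_partition E V' k f"
proof -
  note QD = clique_familyD[OF Q]
  have "\<forall>v\<in>V. \<exists>i<k. card (Q i - nbrs E (Q i) v) \<le> 1"
    using clique_family_near_complete[OF E V Q] by blast
  then obtain f where f: "\<And>v. v \<in> V \<Longrightarrow> f v < k \<and> card (Q (f v) - nbrs E (Q (f v)) v) \<le> 1"
    by metis
  have finQ: "finite (Q i)" if "i < k" for i
    using QD(1)[OF that] V(1) finite_subset by blast
  have nb: "card (nbrs E (Q (f v)) v) + 1 \<ge> 4 * t" if "v \<in> V" for v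
  proof -
    have "f v < k" "card (Q (f v) - nbrs E (Q (f v)) v) \<le> 1" using f[OF that] by auto
    moreover have "card (Q (f v) - nbrs E (Q (f v)) v) = 4 * t - card (nbrs E (Q (f v)) v)"
      using QD(2) finQ f[OF that] nbrs_subset[of E "Q (f v)" v] by (simp add: card_Diff_subset)
    ultimately show ?thesis by linarith
  qed
  define QQ where "QQ = (\<Union>i<k. Q i)"
  note QQ = card_disjoint_family[OF Q V(1), folded QQ_def]
  \<comment> \<open>At least \<open>4 * t - 1\<close> of these neighbours lie in the clique assigned
    to \<open>v\<close>, so a vertex of \<open>V'\<close> has fewer than \<open>t\<close> neighbours
    in any other clique.\<close>
  define V' where "V' = {v \<in> V. card (nbrs E QQ v) < 4 * t - 1 + t}"
  have split: "card (nbrs E QQ v) \<ge> card (nbrs E (Q (f v)) v) + card (nbrs E (Q j) v)"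
    if "v \<in> V" "j < k" "j \<noteq> f v" for v j
  proof -
    have "Q j \<inter> Q (f v) = {}" using QD(4) that f by blast
    then have "card (nbrs E (Q (f v)) v) + card (nbrs E (Q j) v) =
        card (nbrs E (Q (f v)) v \<union> nbrs E (Q j) v)"
      using finQ that f by (subst card_Un_disjoint) (auto simp: nbrs_def)
    also have "\<dots> \<le> card (nbrs E QQ v)"
      using QQ(2) that f by (intro card_mono) (auto simp: nbrs_def QQ_def)
    finally show ?thesis .
  qed
  have few: "card (nbrs E (Q j) v) < t" if "v \<in> V'" "j < k" "j \<noteq> f v" for v j
    using split[of v j] nb[of v] that by (auto simp: V'_def)
  have "near_clique_partition E V' k f"
  proof (rule near_clique_partitionI[OF E])
    show "finite V'" using V(1) by (simp add: V'_def)
    show "f v < k" if "v \<in> V'" for v using that f by (auto simp: V'_def)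
    fix v u w
    assume vuw: "v \<in> V'" "u \<in> V'" "w \<in> V'" "f u = f v" "f w = f v"
      and ne: "v \<noteq> u" "v \<noteq> w" "u \<noteq> w" and na: "\<not> E v u" "\<not> E v w"
    define A where "A j = Q j - (\<Union>s\<in>{v, u, w}. nbrs E (Q j) s)" for j
    define J where "J = {..<k} - {f v}"
    have fv: "f v < k" using vuw(1) f by (auto simp: V'_def)
    \<comment> \<open>Three vertices exclude at most \<open>3 * t - 3\<close> vertices of another
      clique; the clique size \<open>4 * t\<close> leaves room for this.\<close>
    have A2: "card (A j) \<ge> 2" if "j \<in> J" for j
    proof -
      have j: "j < k" "j \<noteq> f v" using that by (auto simp: J_def)
      have "card (\<Union>s\<in>{v, u, w}. nbrs E (Q j) s) \<le> (\<Sum>s\<in>{v, u, w}. card (nbrs E (Q j) s))"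
        by (intro card_UN_le) auto
      also have "\<dots> = card (nbrs E (Q j) v) + card (nbrs E (Q j) u) + card (nbrs E (Q j) w)"
        using ne by simp
      also have "\<dots> + 3 \<le> 3 * t" using few[of v j] few[of u j] few[of w j] vuw j by auto
      finally have "card (\<Union>s\<in>{v, u, w}. nbrs E (Q j) s) + 3 \<le> 3 * t" by simp
      moreover have "card (A j) \<ge> card (Q j) - card (\<Union>s\<in>{v, u, w}. nbrs E (Q j) s)"
        unfolding A_def by (rule diff_card_le_card_Diff) (use finQ j in auto)
      ultimately show ?thesis using QD(2)[OF j(1)] by simp
    qed
    have notin: "s \<notin> Q j" if "s \<in> {v, u, w}" "j \<in> J" for s j
    proof
      assume s: "s \<in> Q j"
      have j: "j < k" "j \<noteq> f s" "s \<in> V'" using that vuw by (auto simp: J_def)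
      have "Q j - {s} \<subseteq> nbrs E (Q j) s" using QD(3)[OF j(1) s] by (auto simp: nbrs_def)
      then have "card (Q j - {s}) \<le> card (nbrs E (Q j) s)" using finQ j by (intro card_mono) auto
      then have "4 * t - 1 \<le> card (nbrs E (Q j) s)" using s QD(2)[OF j(1)] by simp
      then show False using few[OF j(3,1,2)] by simp
    qed
    have "card {v, u, w} + 2 * card J \<le> 2 * k"
    proof (rule greedy_pairs_diss[where A = A and g = 0 and K = k, OF E _ _ V(2,1)])
      show "card (nbrs E (A j) x) \<le> 0" if "i \<in> J" "j \<in> J" "i \<noteq> j" "x \<in> A i" for i j x
      proof -
        have "nbrs E (A j) x = {}" using QD(5)[of i j x] that by (auto simp: A_def J_def nbrs_def)
        then show ?thesis by simp
      qed
      show "sparse E {v, u, w}" using sparse_cherry[OF E na] .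
      show "card J \<le> k" using fv by (simp add: J_def)
      show "A i \<inter> A j = {}" if "i \<in> J" "j \<in> J" "i \<noteq> j" for i j
        using QD(4)[of i j] that by (auto simp: A_def J_def)
      show "x \<noteq> s \<and> \<not> E s x" if "j \<in> J" "s \<in> {v, u, w}" "x \<in> A j" for j s x
        using notin[OF that(2,1)] that(2,3) by (auto simp: A_def nbrs_def)
      show "A j \<subseteq> V" if "j \<in> J" for j using QD(1)[of j] that by (auto simp: A_def J_def)
      show "2 * 0 * k + 2 \<le> card (A j)" if "j \<in> J" for j using A2[OF that] by simp
    qed (use vuw in \<open>auto simp: J_def V'_def\<close>)
    then show False using ne fv by (simp add: J_def)
  qed
  moreover have "t * real (card (V - V')) \<le> 2 * card V"
  proof -
    \<comment> \<open>Every vertex sends at least \<open>4 * t - 1\<close> arcs to the cliques, a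
      discarded one at least \<open>t\<close> more. The degree bound allows
      \<open>(4 * t + 1) * card V\<close> in total, so only \<open>2 * card V\<close> arcs are left
      to pay for the discarded vertices.\<close>
    have "card V * (4 * t - 1) + card (V - V') * t =
        (\<Sum>v\<in>V. (4 * t - 1) + (if v \<in> V' then 0 else t))"
      using V(1) by (simp add: sum.distrib sum.If_cases Diff_eq Compl_eq)
    also have "\<dots> \<le> (\<Sum>v\<in>V. card (nbrs E QQ v))"
    proof (rule sum_mono)
      fix v assume v: "v \<in> V"
      have "card (nbrs E (Q (f v)) v) \<le> card (nbrs E QQ v)"
        using QQ(2) f[OF v] by (intro card_mono) (auto simp: nbrs_def QQ_def)
      then show "(4 * t - 1) + (if v \<in> V' then 0 else t) \<le> card (nbrs E QQ v)"
        using nb[OF v] v by (auto simp: V'_def)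
    qed
    also have "\<dots> = (\<Sum>q\<in>QQ. card (nbrs E V q))"
      by (rule sum_card_nbrs_swap[OF E V(1) QQ(2)])
    finally have "real (card V * (4 * t - 1) + card (V - V') * t) \<le> (\<Sum>q\<in>QQ. real (card (nbrs E V q)))"
      by (metis of_nat_le_iff of_nat_sum)
    also have "\<dots> \<le> card QQ * D" using deg QQ(3) by (intro sum_bounded_above) auto
    also have "\<dots> = real k * 4 * t * D" using QQ(1) by simp
    also note D
    finally have "real (card V) * real (4 * t - 1) + real (card (V - V')) * t \<le> (4 * t + 1) * real (card V)"
      by (simp add: distrib_right)
    moreover have "real (4 * t - 1) = 4 * real t - 1" using t by simp
    ultimately show ?thesis by (simp add: algebra_simps)
  qed
  moreover have "V' \<subseteq> V" by (auto simp: V'_def)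
  ultimately show ?thesis using that by blast
qed

section \<open>Partition into near-cliques\<close>

text \<open>Sorting relative to cliques of constant size may lose up to n / (20 k^2) vertices. Its
  classes, however, have linear size and can take the place of the cliques in a second extension
  argument that covers all vertices. Edges between these classes do occur, which is why the greedy
  choice allows a cross degree \<open>g\<close>.\<close>

lemma near_clique_partition_exists:
  fixes k :: nat
  assumes k: "k > 0"
  defines "\<epsilon> \<equiv> 1 / (160 * real k ^ 3)"
  shows "\<exists>N. \<forall>(V::'a set) E. sgraph E \<longrightarrow> finite V \<longrightarrow> diss_le E V (2 * k) \<longrightarrow> card V \<ge> N \<longrightarrow>
    (\<forall>v\<in>V. real (card (nbrs E V v)) \<le> (1 / k + \<epsilon>) * card V) \<longrightarrow>
    (\<exists>f. near_clique_partition E V k f \<and> (\<forall>i<k. \<exists>v\<in>V. f v = i))"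
proof -
  \<comment> \<open>Matches \<epsilon> through \<open>k * \<epsilon> = 1 / (4 * t)\<close>: the
    \<open>k\<close> cliques of size \<open>4 * t\<close> then send out at most
    \<open>(4 * t + 1) * n\<close> arcs. At most \<open>2 * n / t\<close> vertices are discarded, a
    small fraction of n / k^2.\<close>
  define t where "t = 40 * k\<^sup>2"
  have t: "t > 0" using k by (simp add: t_def)
  have k1: "real k \<ge> 1" using k by simp
  have \<epsilon>: "\<epsilon> > 0" using k by (simp add: \<epsilon>_def)
  have k\<epsilon>: "real k * \<epsilon> = 1 / (4 * t)"
    using k by (simp add: \<epsilon>_def t_def power2_eq_square power3_eq_cube)
  have "\<exists>N. \<forall>(V::'a set) E. sgraph E \<longrightarrow> finite V \<longrightarrow> diss_le E V (2 * k) \<longrightarrow> card V \<ge> N \<longrightarrow>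
      (\<forall>v\<in>V. real (card (nbrs E V v)) \<le> (1 / k + \<epsilon>) * card V) \<longrightarrow>
      (\<exists>Q. clique_family E V k (4 * t) Q)"
  proof (rule exists_clique_family)
    have "\<epsilon> * real k < 1 / real k + \<epsilon>"
    proof -
      have "1 / (4 * t) \<le> 1 / real k"
        using k by (intro divide_left_mono) (auto simp: t_def power2_eq_square)
      then show ?thesis using k\<epsilon> \<epsilon> by (simp add: mult.commute)
    qed
    then show "real k * (1 / real k + \<epsilon>) < 1 + (1 / real k + \<epsilon>)"
      using k by (simp add: algebra_simps)
  qed (use \<epsilon> in auto)
  then obtain N where N: "\<And>(V::'a set) E. sgraph E \<Longrightarrow> finite V \<Longrightarrow> diss_le E V (2 * k) \<Longrightarrow>
      card V \<ge> N \<Longrightarrow> (\<forall>v\<in>V. real (card (nbrs E V v)) \<le> (1 / k + \<epsilon>) * card V) \<Longrightarrow>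
      \<exists>Q. clique_family E V k (4 * t) Q" by metis
  show ?thesis
  proof (intro exI[of _ "max N (1000 * k ^ 3)"] allI impI)
    fix V :: "'a set" and E
    assume E: "sgraph E" and V: "finite V" "diss_le E V (2 * k)" "max N (1000 * k ^ 3) \<le> card V"
      and deg: "\<forall>v\<in>V. real (card (nbrs E V v)) \<le> (1 / k + \<epsilon>) * card V"
    define n where "n = real (card V)"
    define x where "x = n / k"
    define D where "D = (1 / k + \<epsilon>) * n"
    have deg': "real (card (nbrs E V v)) \<le> D" if "v \<in> V" for v
      using deg that by (auto simp: D_def n_def)
    have n: "n \<ge> 1000 * real k ^ 3"
    proof -
      have "1000 * k ^ 3 \<le> card V" using V(3) by simp
      then have "real (1000 * k ^ 3) \<le> real (card V)" by (simp only: of_nat_le_iff)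
      then show ?thesis by (simp add: n_def)
    qed
    have xk2: "x \<ge> 1000 * real k ^ 2"
      using n k by (simp add: x_def field_simps power2_eq_square power3_eq_cube)
    have xk: "x \<ge> 1000 * real k"
    proof -
      have "real k ^ 2 \<ge> real k" using k1 by (simp add: power2_eq_square)
      then show ?thesis using xk2 by linarith
    qed
    have \<epsilon>x: "\<epsilon> * n = x / (160 * real k ^ 2)"
      using k by (simp add: \<epsilon>_def x_def field_simps power2_eq_square power3_eq_cube)
    have D: "D = x + x / (160 * real k ^ 2)"
      using \<epsilon>x by (simp add: D_def algebra_simps x_def)
    have D0: "D \<ge> 0" using \<epsilon> by (simp add: D_def n_def)
    \<comment> \<open>\<open>x\<close> is the size of a balanced class and \<open>y\<close> the unit
      of error: cross degrees of order \<open>y\<close>, multiplied by \<open>2 * k\<close> in the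
      greedy choice, are still only a fraction of \<open>x\<close>.\<close>
    define y where "y = x / k"
    have x_y: "x = k * y" using k by (simp add: y_def)
    have y: "y \<ge> 1000 * real k"
      using xk2 k by (simp add: y_def field_simps power2_eq_square)
    have yx: "y \<le> x" using k1 xk by (simp add: y_def field_simps mult_right_mono)
    have \<epsilon>y: "x / (160 * real k ^ 2) = y / (160 * real k)"
      by (simp add: y_def power2_eq_square)
    have small: "x / (160 * real k ^ 2) \<le> y / 160" "(real k - 1) * (x / (160 * real k ^ 2)) \<le> y / 160"
    proof -
      show "x / (160 * real k ^ 2) \<le> y / 160"
        unfolding \<epsilon>y using y k1 by (intro divide_left_mono) auto
      have "(real k - 1) * (y / (160 * real k)) \<le> real k * (y / (160 * real k))"
        using y k1 by (intro mult_right_mono) auto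
      also have "\<dots> = y / 160" using k by simp
      finally show "(real k - 1) * (x / (160 * real k ^ 2)) \<le> y / 160" unfolding \<epsilon>y .
    qed
    have D_le: "D \<le> x + y / 160" using small(1) unfolding D by simp
    define s where "s = (real k - 1) * (x / (160 * real k ^ 2))"
    have s: "s \<le> y / 160" using small(2) by (simp only: s_def)
    have kD2: "n - (real k - 1) * (D + 2) = x - s - 2 * real k + 2"
    proof -
      have "(real k - 1) * (x + e + 2) = (real k * x - x) + (real k - 1) * e + 2 * (real k - 1)" for e
        by (simp add: algebra_simps)
      then show ?thesis using k unfolding D s_def by (simp add: x_def)
    qed
    have yk: "2 * real k \<le> y / 160" using y k1 by linarith
    obtain Q where Q: "clique_family E V k (4 * t) Q"
      using N[OF E V(1,2)] V(3) deg by auto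
    have kD: "real k * 4 * t * D \<le> real ((4 * t + 1) * card V)"
    proof -
      have "real k * D = n + real k * \<epsilon> * n" using k by (simp add: D_def field_simps)
      then have "4 * t * (real k * D) = 4 * t * n + n" using t unfolding k\<epsilon> by (simp add: field_simps)
      then show ?thesis by (simp add: n_def algebra_simps)
    qed
    obtain V' f where V': "V' \<subseteq> V" "t * real (card (V - V')) \<le> real (2 * card V)"
      and f: "near_clique_partition E V' k f"
      by (rule typical_vertices[OF E V(1,2) Q t deg' kD])
    have finV': "finite V'" using V' V(1) finite_subset by blast
    define W where "W i = {u \<in> V'. f u = i}" for i
    have W: "W i \<subseteq> V" "finite (W i)" for i using V' finV' by (auto simp: W_def)
    have bad: "real (card (V - V')) \<le> y / 20"
    proof -
      have "40 * real k ^ 2 * card (V - V') \<le> 2 * (x * k)"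
        using V'(2) k by (simp add: t_def x_def n_def)
      then have "k ^ 2 * (40 * real (card (V - V'))) \<le> k ^ 2 * (2 * y)"
        by (simp add: x_y power2_eq_square algebra_simps)
      then show ?thesis using k by (simp add: mult_le_cancel_left)
    qed
    \<comment> \<open>The loss \<open>y / 16\<close> is made up of \<open>y / 20\<close> for the
      discarded vertices and \<open>y / 160\<close> for each of \<open>s\<close> and
      \<open>2 * k\<close>.\<close>
    have W_lower: "card (W i) \<ge> x - y / 16" if "i < k" for i
    proof -
      have dV': "real (card (nbrs E V' v)) \<le> D" if "v \<in> V'" for v
      proof -
        have "card (nbrs E V' v) \<le> card (nbrs E V v)"
          using V(1) V'(1) by (intro card_mono) (auto simp: nbrs_def)
        then show ?thesis using deg'[of v] that V'(1) by force
      qed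
      have "card (W i) \<ge> card V' - (real k - 1) * (D + 2)"
        unfolding W_def by (rule near_clique_partition_class_bounds(2)[OF f finV' D0 dV' that])
      moreover have "real (card V') = n - card (V - V')"
        using V'(1) V(1) finV' by (simp add: n_def card_Diff_subset card_mono)
      ultimately have "x - s - 2 * real k + 2 - card (V - V') \<le> card (W i)" using kD2 by simp
      then show ?thesis using bad s yk by linarith
    qed
    have outside: "real (card (nbrs E V v) - card (nbrs E (W i) v)) \<le> D - r"
      if "v \<in> V" "real (card (nbrs E (W i) v)) \<ge> r" for v i r
    proof -
      have "card (nbrs E (W i) v) \<le> card (nbrs E V v)"
        using V(1) W by (intro card_mono) (auto simp: nbrs_def)
      then show ?thesis using deg'[OF that(1)] that(2) by (simp add: of_nat_diff)
    qed
    have other: "card (nbrs E (W j) v) \<le> card (nbrs E V v) - card (nbrs E (W i) v)"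
      if "i \<noteq> j" for v i j
    proof -
      have "card (nbrs E (W i) v) + card (nbrs E (W j) v) = card (nbrs E (W i) v \<union> nbrs E (W j) v)"
        using that by (intro card_Un_disjoint[symmetric] finite_nbrs W) (auto simp: nbrs_def W_def)
      also have "\<dots> \<le> card (nbrs E V v)"
        using V(1) W by (intro card_mono) (auto simp: nbrs_def)
      finally show ?thesis by simp
    qed
    \<comment> \<open>A vertex of a class has nearly \<open>x\<close> neighbours inside it, and the
      degree bound leaves at most \<open>D - (x - y / 16 - 2) \<le> y / 12\<close> outside.\<close>
    define g where "g = nat \<lfloor>y / 12\<rfloor>"
    have g: "real g \<le> y / 12" "y / 12 < real g + 1" 
    proof -
      have "real g = of_int \<lfloor>y / 12\<rfloor>" using y k1 by (simp add: g_def)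
      then show "real g \<le> y / 12" "y / 12 < real g + 1" by linarith+
    qed
    have W_deg: "card (nbrs E (W j) v) \<le> g" if "i < k" "j \<noteq> i" "v \<in> W i" for i j v
    proof -
      have v: "v \<in> V'" "f v = i" using that by (auto simp: W_def)
      have "card (W i) \<le> card (nbrs E (W i) v) + 2"
        using near_clique_partition_nbrs[OF f finV' v(1)] v(2) by (simp add: W_def)
      then have "real (card (nbrs E (W i) v)) \<ge> x - y / 16 - 2"
        using W_lower[OF that(1)] by linarith
      then have "real (card (nbrs E V v) - card (nbrs E (W i) v)) \<le> D - (x - y / 16 - 2)"
        using outside v V' by blast
      then have "real (card (nbrs E (W j) v)) \<le> D - (x - y / 16 - 2)"
        using other[of i j v] that(2) by force
      then have "real (card (nbrs E (W j) v)) \<le> y / 12"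
        using D_le y k1 by linarith
      then show ?thesis using g by linarith
    qed
    have gk: "2 * g * k \<le> x / 6"
    proof -
      have "2 * real g * k \<le> 2 * (y / 12) * k" using g by (intro mult_right_mono) auto
      then show ?thesis by (simp add: x_y mult.commute)
    qed
    \<comment> \<open>Otherwise \<open>b\<close> and a pair from each class would form a
      dissociation set of size \<open>2 * k + 1\<close>. The vertex \<open>b\<close> is removed from
      the sets because it may lie in one of the classes.\<close>
    have "\<exists>i<k. card (W i - insert b (nbrs E (W i) b)) < 2 * g * k + 2" if b: "b \<in> V" for b
    proof (rule ccontr)
      assume *: "\<not> ?thesis"
      have "card {b} + 2 * card {..<k} \<le> 2 * k"
      proof (rule greedy_pairs_diss[where A = "\<lambda>i. W i - insert b (nbrs E (W i) b)" and g = g and K = k,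
            OF E _ _ V(2,1)])
        show "sparse E {b}" using sparse_doubleton[OF E, of b b] by simp
        show "2 * g * k + 2 \<le> card (W j - insert b (nbrs E (W j) b))" if "j \<in> {..<k}" for j
          using * that by (meson lessThan_iff not_less)
        show "card (nbrs E (W j - insert b (nbrs E (W j) b)) v) \<le> g"
          if "i \<in> {..<k}" "j \<in> {..<k}" "i \<noteq> j" "v \<in> W i - insert b (nbrs E (W i) b)" for i j v
        proof -
          have "card (nbrs E (W j - insert b (nbrs E (W j) b)) v) \<le> card (nbrs E (W j) v)"
            using W by (intro card_mono) (auto simp: nbrs_def)
          also have "\<dots> \<le> g" using W_deg[of i j v] that by auto
          finally show ?thesis .
        qed
      qed (use b W in \<open>auto simp: nbrs_def W_def\<close>)
      then show False by simp
    qed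
    then obtain h where h: "\<And>b. b \<in> V \<Longrightarrow> h b < k"
      "\<And>b. b \<in> V \<Longrightarrow> card (W (h b) - insert b (nbrs E (W (h b)) b)) < 2 * g * k + 2" by metis
    \<comment> \<open>Up to about \<open>2 * g * k \<le> x / 6\<close> vertices of the class
      \<open>W (h b)\<close> may be missed, so the bound on cross degrees weakens to
      \<open>x / 4\<close>. Three such vertices still leave at least \<open>x / 6 + 2\<close>
      vertices of any other class, enough for the greedy choice.\<close>
    have h_deg: "real (card (nbrs E (W j) b)) \<le> x / 4" if "b \<in> V" "j \<noteq> h b" for b j
    proof -
      have "card (W (h b)) - card (insert b (nbrs E (W (h b)) b)) \<le>
          card (W (h b) - insert b (nbrs E (W (h b)) b))"
        using W by (intro diff_card_le_card_Diff) auto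
      moreover have "card (insert b (nbrs E (W (h b)) b)) \<le> card (nbrs E (W (h b)) b) + 1"
        using W by (simp add: card_insert_if)
      ultimately have "card (W (h b)) \<le> card (nbrs E (W (h b)) b) + 2 + 2 * g * k"
        using h(2)[OF that(1)] by linarith
      then have "real (card (W (h b))) \<le> real (card (nbrs E (W (h b)) b) + 2 + 2 * g * k)"
        by (simp only: of_nat_le_iff)
      then have "real (card (W (h b))) \<le> card (nbrs E (W (h b)) b) + 2 + 2 * g * k"
        by simp
      then have "real (card (nbrs E (W (h b)) b)) \<ge> x - y / 16 - 2 - x / 6"
        using W_lower[OF h(1)[OF that(1)]] gk by linarith
      then have "real (card (nbrs E V b) - card (nbrs E (W (h b)) b)) \<le> D - (x - y / 16 - 2 - x / 6)"
        using outside that(1) by blast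
      then have "real (card (nbrs E (W j) b)) \<le> D - (x - y / 16 - 2 - x / 6)"
        using other[of "h b" j b] that(2) by force
      then show ?thesis using D_le y yx k1 by linarith
    qed
    have hp: "near_clique_partition E V k h"
    proof (rule near_clique_partitionI[OF E V(1)])
      fix v u w
      assume vuw: "v \<in> V" "u \<in> V" "w \<in> V" "h u = h v" "h w = h v"
        and ne: "v \<noteq> u" "v \<noteq> w" "u \<noteq> w" and na: "\<not> E v u" "\<not> E v w"
      define A where "A j = W j - ({v, u, w} \<union> (nbrs E (W j) v \<union> nbrs E (W j) u \<union> nbrs E (W j) w))" for j
      define J where "J = {..<k} - {h v}"
      have A2: "card (A j) \<ge> 2 * g * k + 2" if "j \<in> J" for j
      proof -
        have j: "j < k" "j \<noteq> h v" using that by (auto simp: J_def)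
        have "card ({v, u, w} \<union> (nbrs E (W j) v \<union> nbrs E (W j) u \<union> nbrs E (W j) w)) \<le>
           3 + (card (nbrs E (W j) v) + card (nbrs E (W j) u) + card (nbrs E (W j) w))"
          using ne by (intro order.trans[OF card_Un_le] add_mono order.trans[OF card_Un_le[of "_ \<union> _"]] card_Un_le) auto
        moreover have "card (W j) - card ({v, u, w} \<union> (nbrs E (W j) v \<union> nbrs E (W j) u \<union> nbrs E (W j) w)) \<le> card (A j)"
          unfolding A_def using W by (intro diff_card_le_card_Diff) auto
        ultimately have "real (card (W j)) \<le> card (A j) + 3 +
            (real (card (nbrs E (W j) v)) + card (nbrs E (W j) u) + card (nbrs E (W j) w))"
          by linarith
        then have "real (card (A j)) \<ge> x / 6 + 2"
          using h_deg[of v j] h_deg[of u j] h_deg[of w j] vuw j W_lower[OF j(1)] yx y k1 by simp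
        then have "real (2 * g * k + 2) \<le> card (A j)" using gk by simp
        then show ?thesis by (simp only: of_nat_le_iff)
      qed
      have "card {v, u, w} + 2 * card J \<le> 2 * k"
      proof (rule greedy_pairs_diss[where A = A and g = g and K = k, OF E _ _ V(2,1)])
        show "card (nbrs E (A j) z) \<le> g" if "i \<in> J" "j \<in> J" "i \<noteq> j" "z \<in> A i" for i j z
        proof -
          have "card (nbrs E (A j) z) \<le> card (nbrs E (W j) z)"
            using W by (intro card_mono) (auto simp: nbrs_def A_def)
          also have "\<dots> \<le> g" using W_deg[of i j z] that by (auto simp: J_def A_def)
          finally show ?thesis .
        qed
        show "sparse E {v, u, w}" using sparse_cherry[OF E na] .
        show "card J \<le> k" using h(1)[OF vuw(1)] by (simp add: J_def)
        show "A i \<inter> A j = {}" if "i \<in> J" "j \<in> J" "i \<noteq> j" for i j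
          using that by (auto simp: A_def W_def)
        show "z \<noteq> s \<and> \<not> E s z" if "j \<in> J" "s \<in> {v, u, w}" "z \<in> A j" for j s z
          using that(2,3) by (auto simp: A_def nbrs_def)
        show "A j \<subseteq> V" for j using W by (auto simp: A_def)
        show "2 * g * k + 2 \<le> card (A j)" if "j \<in> J" for j using A2[OF that] .
      qed (use vuw in \<open>auto simp: J_def\<close>)
      then show False using ne h(1)[OF vuw(1)] by (simp add: J_def)
    qed (rule h(1))
    \<comment> \<open>The other \<open>k - 1\<close> classes are too small to cover
      \<open>V\<close>.\<close>
    have "\<exists>v\<in>V. h v = i" if "i < k" for i
    proof -
      have "x - s - 2 * real k + 2 \<le> card {u \<in> V. h u = i}"
        using near_clique_partition_class_bounds(2)[OF hp V(1) D0 deg' that] kD2 by (simp add: n_def)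
      then have "real (card {u \<in> V. h u = i}) > 0" using s yx yk k1 by linarith
      then have "card {u \<in> V. h u = i} > 0" by simp
      then show ?thesis by (auto simp: card_gt_0_iff)
    qed
    then show "\<exists>f. near_clique_partition E V k f \<and> (\<forall>i<k. \<exists>v\<in>V. f v = i)" using hp by blast
  qed
qed

section \<open>The minimum number of edges\<close>

definition arc_count :: "('a \<Rightarrow> 'a \<Rightarrow> bool) \<Rightarrow> 'a set \<Rightarrow> nat" where
  "arc_count E V = (\<Sum>v\<in>V. card (nbrs E V v))"

lemma arc_count_remove:
  assumes E: "sgraph E" and "finite V" "v \<in> V"
  shows "arc_count E V = arc_count E (V - {v}) + 2 * card (nbrs E V v)"
proof -
  have split: "card (nbrs E V u) = card (nbrs E (V - {v}) u) + (if E u v then 1 else 0)" for u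
  proof -
    have "nbrs E V u = nbrs E (V - {v}) u \<union> (if E u v then {v} else {})"
      using assms by (auto simp: nbrs_def)
    then show ?thesis using assms by (simp add: nbrs_def)
  qed
  have "nbrs E V v = {u \<in> V - {v}. E u v}"
    using assms(1,3) sgraph_sym[OF E] by (auto simp: nbrs_def)
  then have "card (nbrs E V v) = (\<Sum>u\<in>V - {v}. if E u v then 1 else 0)"
    using assms(2) by (simp add: sum.If_cases Int_def)
  moreover have "arc_count E V = card (nbrs E V v) + (\<Sum>u\<in>V - {v}. card (nbrs E V u))"
    unfolding arc_count_def using assms by (simp add: sum.remove)
  ultimately show ?thesis
    by (simp add: split sum.distrib arc_count_def)
qed

definition cross_count :: "('a \<Rightarrow> 'a \<Rightarrow> bool) \<Rightarrow> 'a set \<Rightarrow> ('a \<Rightarrow> nat) \<Rightarrow> nat" where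
  "cross_count E V f = card {(u, v). u \<in> V \<and> v \<in> V \<and> E u v \<and> f u \<noteq> f v}"

text \<open>A vertex in a class of size \<open>m i\<close> has at least \<open>m i - 2\<close>
  neighbours there. Summed over the vertices this gives the squares of the class sizes, which
  Cauchy-Schwarz bounds below by the balanced case.\<close>

lemma arc_count_near_clique_partition:
  assumes "finite V" "near_clique_partition E V k f" "k > 0"
  shows "real (card V) ^ 2 / k - 2 * card V + cross_count E V f \<le> arc_count E V"
proof -
  define m where "m i = real (card {u \<in> V. f u = i})" for i
  have fk: "f v < k" if "v \<in> V" for v using assms(2) that by (simp add: near_clique_partition_def)
  have deg: "m (f v) - 2 + card {u \<in> V. E v u \<and> f v \<noteq> f u} \<le> card (nbrs E V v)" if "v \<in> V" for v
  proof -
    have "nbrs E V v = nbrs E {u \<in> V. f u = f v} v \<union> {u \<in> V. E v u \<and> f v \<noteq> f u}"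
      by (auto simp: nbrs_def)
    then have "card (nbrs E V v) = card (nbrs E {u \<in> V. f u = f v} v) + card {u \<in> V. E v u \<and> f v \<noteq> f u}"
      using assms(1) by (simp add: nbrs_def card_Un_disjoint disjoint_iff)
    then show ?thesis
      using near_clique_partition_nbrs[OF assms(2,1) that] by (simp add: m_def)
  qed
  have "{(u, v). u \<in> V \<and> v \<in> V \<and> E u v \<and> f u \<noteq> f v} = (SIGMA v:V. {u \<in> V. E v u \<and> f v \<noteq> f u})"
    by auto
  then have "cross_count E V f = (\<Sum>v\<in>V. card {u \<in> V. E v u \<and> f v \<noteq> f u})"
    using assms(1) by (simp add: cross_count_def)
  then have "(\<Sum>v\<in>V. m (f v)) - 2 * card V + cross_count E V f =
      (\<Sum>v\<in>V. m (f v) - 2 + card {u \<in> V. E v u \<and> f v \<noteq> f u})"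
    by (simp add: sum.distrib sum_subtractf)
  also have "\<dots> \<le> (\<Sum>v\<in>V. real (card (nbrs E V v)))" using deg by (intro sum_mono) auto
  also have "\<dots> = arc_count E V" by (simp add: arc_count_def)
  finally have "(\<Sum>v\<in>V. m (f v)) - 2 * card V + cross_count E V f \<le> arc_count E V" .
  moreover have "(\<Sum>v\<in>V. m (f v)) = (\<Sum>i<k. m i ^ 2)"
  proof -
    have "(\<Sum>v\<in>V. m (f v)) = (\<Sum>i<k. \<Sum>v\<in>{u \<in> V. f u = i}. m (f v))"
      using fk by (intro sum.group[symmetric] assms) auto
    then show ?thesis by (simp add: m_def power2_eq_square)
  qed
  moreover have "(\<Sum>i<k. m i) = card V"
    using sum_card_classes[OF assms(1), of f k] fk unfolding m_def of_nat_sum[symmetric] by simp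
  then have "real (card V) ^ 2 \<le> (\<Sum>i<k. m i ^ 2) * k"
    using sum_squared_le_sum_of_squares[of m "{..<k}"] by simp
  then have "real (card V) ^ 2 / k \<le> (\<Sum>i<k. m i ^ 2)"
    using assms(3) by (simp add: divide_le_eq)
  ultimately show ?thesis by linarith
qed

text \<open>With the classes contracted to points the graph stays connected, so it contains a tree
  with \<open>k - 1\<close> edges. The tree is grown one class at a time: the cut around the union
  of the classes in \<open>P\<close> supplies an edge to a new class.\<close>

lemma cross_count_ge:
  assumes E: "sgraph E" and V: "finite V" and f: "\<And>v. v \<in> V \<Longrightarrow> f v < k" "\<And>i. i < k \<Longrightarrow> \<exists>v\<in>V. f v = i"
    and conn: "\<And>U. U \<subseteq> V \<Longrightarrow> U \<noteq> {} \<Longrightarrow> U \<noteq> V \<Longrightarrow> \<exists>u\<in>U. \<exists>v\<in>V - U. E u v"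
    and k: "k > 0"
  shows "2 * (k - 1) \<le> cross_count E V f"
proof -
  define X where "X P = {(u, v). u \<in> V \<and> v \<in> V \<and> E u v \<and> f u \<noteq> f v \<and> f u \<in> P \<and> f v \<in> P}" for P
  have finX: "finite (X P)" for P
    by (rule finite_subset[of _ "V \<times> V"]) (use V in \<open>auto simp: X_def\<close>)
  have grow: "\<exists>P\<subseteq>{..<k}. card P = Suc j \<and> 2 * j \<le> card (X P)" if "j < k" for j
    using that
  proof (induction j)
    case 0
    show ?case using k by (intro exI[of _ "{0}"]) auto
  next
    case (Suc j)
    then obtain P where P: "P \<subseteq> {..<k}" "card P = Suc j" "2 * j \<le> card (X P)" by auto
    have "P \<noteq> {..<k}" using P(2) Suc.prems by auto
    then obtain i where i: "i < k" "i \<notin> P" using P(1) by auto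
    obtain i' where i': "i' \<in> P" using P(2) by fastforce
    define U where "U = {v \<in> V. f v \<in> P}"
    have "U \<subseteq> V" by (auto simp: U_def)
    moreover have "U \<noteq> {}" using f(2)[of i'] i' P(1) by (auto simp: U_def)
    moreover have "U \<noteq> V" using f(2)[OF i(1)] i(2) by (auto simp: U_def)
    ultimately obtain u v where uv: "u \<in> U" "v \<in> V - U" "E u v" using conn by blast
    then have uv': "u \<in> V" "v \<in> V" "f u \<in> P" "f v \<notin> P" "f v < k" "E v u" "u \<noteq> v"
      using f(1) sgraph_sym[OF E] by (auto simp: U_def)
    \<comment> \<open>Both orientations of the edge are new because
      \<open>f v \<notin> P\<close>.\<close>
    have "X P \<union> {(u, v), (v, u)} \<subseteq> X (insert (f v) P)"
      using uv uv' by (auto simp: X_def)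
    then have "card (X P \<union> {(u, v), (v, u)}) \<le> card (X (insert (f v) P))"
      using finX by (intro card_mono) auto
    moreover have "card (X P \<union> {(u, v), (v, u)}) = card (X P) + 2"
      using uv' finX by (subst card_Un_disjoint) (auto simp: X_def)
    moreover have "card (insert (f v) P) = Suc (Suc j)"
      using uv'(4) P finite_subset[OF P(1)] by simp
    ultimately show ?case using P(1,3) uv'(5) by (intro exI[of _ "insert (f v) P"]) auto
  qed
  have "k - 1 < k" using k by simp
  from grow[OF this] obtain P where "2 * (k - 1) \<le> card (X P)" by blast
  also have "card (X P) \<le> cross_count E V f"
    unfolding cross_count_def
  proof (rule card_mono)
    show "finite {(u, v). u \<in> V \<and> v \<in> V \<and> E u v \<and> f u \<noteq> f v}"
      by (rule finite_subset[of _ "V \<times> V"]) (use V in auto)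
  qed (auto simp: X_def)
  finally show ?thesis .
qed

text \<open>
  Deleting a vertex of degree above the threshold increases the surplus of arcs over the
  extremal value, so either every vertex is below the threshold or the surplus is already large.
\<close>

lemma arc_count_dichotomy:
  fixes k :: nat
  assumes k: "k > 0"
  shows "\<exists>N. \<forall>(V::'a set) E. sgraph E \<longrightarrow> finite V \<longrightarrow> diss_le E V (2 * k) \<longrightarrow> card V \<ge> N \<longrightarrow>
    real (card V) ^ 2 / k - 2 * card V + 2 * k \<le> arc_count E V \<or>
    (\<exists>f. near_clique_partition E V k f \<and> (\<forall>i<k. \<exists>v\<in>V. f v = i))"
proof -
  define \<epsilon> where "\<epsilon> = 1 / (160 * real k ^ 3)"
  have \<epsilon>: "\<epsilon> > 0" using k by (simp add: \<epsilon>_def)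
  \<comment> \<open>The arc count of \<open>k\<close> equal classes, each lacking a perfect
    matching.\<close>
  define ex where "ex n = real n ^ 2 / k - 2 * n" for n :: nat
  obtain N where N: "\<And>(V::'a set) E. sgraph E \<Longrightarrow> finite V \<Longrightarrow> diss_le E V (2 * k) \<Longrightarrow> card V \<ge> N \<Longrightarrow>
    (\<forall>v\<in>V. real (card (nbrs E V v)) \<le> (1 / k + \<epsilon>) * card V) \<Longrightarrow>
    (\<exists>f. near_clique_partition E V k f \<and> (\<forall>i<k. \<exists>v\<in>V. f v = i))"
    using near_clique_partition_exists[OF k] unfolding \<epsilon>_def by metis
  define K where "K = nat \<lceil>ex N\<rceil>"
  \<comment> \<open>Going from \<open>n\<close> to \<open>Suc n\<close> vertices raises
    \<open>ex\<close> by at most \<open>2 * Suc n / k - 2\<close>, while the deleted vertex carries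
    more than \<open>2 * (1 / k + \<epsilon>) * Suc n\<close> arcs.\<close>
  have step: "arc_count E (V - {v}) - ex (card (V - {v})) + 2 + 2 * \<epsilon> * card V \<le> arc_count E V - ex (card V)"
    if "sgraph E" "finite V" "v \<in> V" "real (card (nbrs E V v)) > (1 / k + \<epsilon>) * card V" for V :: "'a set" and E v
  proof -
    define n where "n = card (V - {v})"
    have n: "card V = Suc n" using that(2,3) by (simp add: n_def card_Suc_Diff1 del: card_Diff_insert)
    have "ex (Suc n) \<le> ex n + 2 * (1 / k * Suc n) - 2"
    proof -
      have "real (Suc n) ^ 2 / k \<le> (real n ^ 2 + 2 * real (Suc n)) / k"
        by (intro divide_right_mono) (auto simp: power2_eq_square algebra_simps)
      then show ?thesis by (simp add: ex_def add_divide_distrib)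
    qed
    moreover have "real (arc_count E V) = arc_count E (V - {v}) + 2 * card (nbrs E V v)"
      using arc_count_remove[OF that(1-3)] by simp
    moreover have "2 * (1 / k * Suc n) + 2 * \<epsilon> * Suc n < 2 * real (card (nbrs E V v))"
    proof -
      have "2 * ((1 / k + \<epsilon>) * Suc n) < 2 * real (card (nbrs E V v))"
        using that(4) unfolding n by simp
      then show ?thesis by (simp only: distrib_right distrib_left mult.assoc)
    qed
    ultimately show ?thesis unfolding n n_def[symmetric] by linarith
  qed
  \<comment> \<open>At \<open>N\<close> vertices the surplus is at least \<open>- K\<close>, since
    arc counts are nonnegative. Each deletion gains at least 2, and a graph with all degrees below
    the threshold has nonnegative surplus at once.\<close>
  have surplus: "arc_count E V - ex (card V) \<ge> min 0 (2 * (real (card V) - N) - K)"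
    if "sgraph E" "finite V" "diss_le E V (2 * k)" "card V = N + j" for V :: "'a set" and E j
    using that
  proof (induction j arbitrary: V)
    case 0
    have "ex (card V) \<le> K" using 0 by (simp add: K_def real_nat_ceiling_ge)
    then show ?case using 0 by simp
  next
    case (Suc j)
    show ?case
    proof (cases "\<forall>v\<in>V. real (card (nbrs E V v)) \<le> (1 / k + \<epsilon>) * card V")
      case True
      then obtain f where "near_clique_partition E V k f" using N Suc.prems by (metis le_add1)
      from arc_count_near_clique_partition[OF Suc.prems(2) this k]
      show ?thesis by (simp add: ex_def)
    next
      case False
      then obtain v where v: "v \<in> V" "real (card (nbrs E V v)) > (1 / k + \<epsilon>) * card V" by force
      have c: "card (V - {v}) = N + j" using v Suc.prems by simp
      have "min 0 (2 * (real (card (V - {v})) - N) - K) \<le> arc_count E (V - {v}) - ex (card (V - {v}))"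
        by (rule Suc.IH) (use Suc.prems c in \<open>auto intro: diss_le_subset\<close>)
      moreover have "0 \<le> 2 * \<epsilon> * card V" using \<epsilon> by simp
      ultimately show ?thesis using step[OF Suc.prems(1,2) v] Suc.prems(4) c by simp
    qed
  qed
  show ?thesis
  \<comment> \<open>After one deletion at least \<open>N + K\<close> vertices remain, which makes
    the surplus of the rest nonnegative; the summand with \<open>k / \<epsilon>\<close> makes that
    one deletion gain at least \<open>2 * k\<close>.\<close>
  proof (intro exI[of _ "Suc N + K + nat \<lceil>k / \<epsilon>\<rceil>"] allI impI)
    fix V :: "'a set" and E
    assume E: "sgraph E" and V: "finite V" "diss_le E V (2 * k)"
      and n: "Suc N + K + nat \<lceil>k / \<epsilon>\<rceil> \<le> card V"
    show "real (card V) ^ 2 / k - 2 * card V + 2 * k \<le> arc_count E V \<or>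
      (\<exists>f. near_clique_partition E V k f \<and> (\<forall>i<k. \<exists>v\<in>V. f v = i))"
    proof (cases "\<forall>v\<in>V. real (card (nbrs E V v)) \<le> (1 / k + \<epsilon>) * card V")
      case True
      then show ?thesis using N[OF E V] n by auto
    next
      case False
      then obtain v where v: "v \<in> V" "real (card (nbrs E V v)) > (1 / k + \<epsilon>) * card V" by force
      define j where "j = card V - Suc N"
      have c: "card (V - {v}) = N + j" "K \<le> j" using v V n by (auto simp: j_def)
      have "min 0 (2 * (real (card (V - {v})) - N) - K) \<le> arc_count E (V - {v}) - ex (card (V - {v}))"
        by (rule surplus[OF E]) (use V c in \<open>auto intro: diss_le_subset\<close>)
      then have "0 \<le> arc_count E (V - {v}) - ex (card (V - {v}))" using c by simp
      moreover have "2 * k \<le> 2 * \<epsilon> * card V"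
      proof -
        have "k / \<epsilon> \<le> nat \<lceil>k / \<epsilon>\<rceil>" by (rule real_nat_ceiling_ge)
        also have "nat \<lceil>k / \<epsilon>\<rceil> \<le> card V" using n by linarith
        finally show ?thesis using \<epsilon> by (simp add: field_simps)
      qed
      ultimately have "2 * k \<le> arc_count E V - ex (card V)" using step[OF E V(1) v] by simp
      then show ?thesis by (simp add: ex_def)
    qed
  qed
qed

text \<open>Vertex deletion may destroy connectedness, so it is applied to the full graph only.
  There either the surplus is already \<open>2 * k\<close>, or the crossing edges of a near-clique
  partition supply \<open>2 * (k - 1)\<close>.\<close>

lemma arc_count_connected_ge:
  fixes k :: nat
  assumes k: "k > 0"
  shows "\<exists>N. \<forall>(V::'a set) E. sgraph E \<longrightarrow> finite V \<longrightarrow> diss_le E V (2 * k) \<longrightarrow> card V \<ge> N \<longrightarrow>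
    (\<forall>U\<subseteq>V. U \<noteq> {} \<longrightarrow> U \<noteq> V \<longrightarrow> (\<exists>u\<in>U. \<exists>v\<in>V - U. E u v)) \<longrightarrow>
    real (card V) ^ 2 / k - 2 * card V + 2 * (real k - 1) \<le> arc_count E V"
proof -
  obtain N where N: "\<And>(V::'a set) E. sgraph E \<Longrightarrow> finite V \<Longrightarrow> diss_le E V (2 * k) \<Longrightarrow> card V \<ge> N \<Longrightarrow>
    real (card V) ^ 2 / k - 2 * card V + 2 * k \<le> arc_count E V \<or>
    (\<exists>f. near_clique_partition E V k f \<and> (\<forall>i<k. \<exists>v\<in>V. f v = i))"
    using arc_count_dichotomy[OF k] by metis
  show ?thesis
  proof (intro exI[of _ N] allI impI)
    fix V :: "'a set" and E
    assume E: "sgraph E" and V: "finite V" "diss_le E V (2 * k)" "N \<le> card V"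
      and conn: "\<forall>U\<subseteq>V. U \<noteq> {} \<longrightarrow> U \<noteq> V \<longrightarrow> (\<exists>u\<in>U. \<exists>v\<in>V - U. E u v)"
    from N[OF E V] show "real (card V) ^ 2 / k - 2 * card V + 2 * (real k - 1) \<le> arc_count E V"
    proof
      assume "\<exists>f. near_clique_partition E V k f \<and> (\<forall>i<k. \<exists>v\<in>V. f v = i)"
      then obtain f where f: "near_clique_partition E V k f" "\<And>i. i < k \<Longrightarrow> \<exists>v\<in>V. f v = i" by blast
      have "2 * (k - 1) \<le> cross_count E V f"
        by (rule cross_count_ge[OF E V(1) _ f(2) _ k])
          (use f(1) conn in \<open>auto simp: near_clique_partition_def\<close>)
      then have "real (2 * (k - 1)) \<le> cross_count E V f" by (simp only: of_nat_le_iff)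
      then have "2 * (real k - 1) \<le> cross_count E V f" using k by (simp add: of_nat_diff)
      then show ?thesis using arc_count_near_clique_partition[OF V(1) f(1) k] by linarith
    qed simp
  qed
qed

section \<open>Rayleigh quotient and Collatz--Wielandt bound\<close>

text \<open>A maximizer of the quadratic form on the unit sphere is an eigenvector: moving it along
  the residual \<open>r\<close> of the eigenvalue equation would gain a multiple of \<open>t\<close>
  times the squared norm of \<open>r\<close>, but maximality allows only a gain of order
  \<open>t^2\<close>.\<close>

lemma rayleigh_maximizer:
  fixes a :: "nat \<Rightarrow> nat \<Rightarrow> real"
  assumes n: "n > 0" and sym: "\<And>i j. a i j = a j i"
  shows "\<exists>x \<mu>. (\<exists>i<n. x i \<noteq> 0) \<and> (\<forall>i<n. (\<Sum>j<n. a i j * x j) = \<mu> * x i) \<and>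
    (\<forall>y. (\<Sum>i<n. \<Sum>j<n. a i j * y i * y j) \<le> \<mu> * (\<Sum>i<n. (y i)\<^sup>2))"
proof -
  define B where "B x y = (\<Sum>i<n. \<Sum>j<n. a i j * x i * y j)" for x y :: "nat \<Rightarrow> real"
  define I where "I x y = (\<Sum>i<n. x i * y i)" for x y :: "nat \<Rightarrow> real"
  have Isq: "I x x = (\<Sum>i<n. (x i)\<^sup>2)" for x by (simp add: I_def power2_eq_square)
  have I0: "I x x \<ge> 0" for x by (simp add: Isq sum_nonneg)
  \<comment> \<open>Coordinates from \<open>n\<close> on are pinned to 0, so that the box is compact
    by Tychonoff's theorem although the index type is infinite.\<close>
  define P where "P = PiE UNIV (\<lambda>i::nat. if i < n then {-1..1::real} else {0})"
  have "compact P"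
  proof -
    have "compactin (product_topology (\<lambda>_. euclidean) UNIV) P"
      unfolding P_def compactin_PiE by auto
    then show ?thesis
      by (simp add: euclidean_product_topology)
  qed
  moreover have "closed {x. I x x = 1}"
    unfolding I_def
    by (intro closed_Collect_eq continuous_on_sum continuous_on_mult continuous_on_const
        continuous_on_product_coordinates)
  ultimately have comp: "compact (P \<inter> {x. I x x = 1})" by (rule compact_Int_closed)
  have inS: "(\<lambda>i. if i < n then y i / sqrt (I y y) else 0) \<in> P \<inter> {x. I x x = 1}" if "I y y \<noteq> 0" for y
  proof -
    have pos: "I y y > 0" using I0[of y] that by linarith
    have "- 1 \<le> y i / sqrt (I y y) \<and> y i / sqrt (I y y) \<le> 1" if "i < n" for i
    proof -
      have "(y i)\<^sup>2 \<le> I y y" unfolding Isq using that by (intro member_le_sum) auto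
      then have "\<bar>y i\<bar> \<le> sqrt (I y y)" by (metis real_sqrt_abs real_sqrt_le_iff)
      then show ?thesis using pos by (simp add: abs_le_iff le_divide_eq divide_le_eq)
    qed
    then have "(\<lambda>i. if i < n then y i / sqrt (I y y) else 0) \<in> P"
      by (auto simp: P_def)
    moreover have "I (\<lambda>i. if i < n then y i / sqrt (I y y) else 0) (\<lambda>i. if i < n then y i / sqrt (I y y) else 0)
        = (\<Sum>i<n. y i * y i / I y y)"
      unfolding I_def[of "\<lambda>i. if i < n then y i / sqrt (I y y) else 0"]
      using pos by (intro sum.cong) auto
    ultimately show ?thesis using pos by (simp add: I_def flip: sum_divide_distrib)
  qed
  have ne: "P \<inter> {x. I x x = 1} \<noteq> {}"
  proof -
    have "I (\<lambda>_. 1) (\<lambda>_. 1) \<noteq> 0" using n by (simp add: I_def)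
    then show ?thesis using inS by blast
  qed
  have "continuous_on (P \<inter> {x. I x x = 1}) (\<lambda>x. B x x)"
    unfolding B_def
    by (rule continuous_on_subset[OF _ subset_UNIV])
      (intro continuous_on_sum continuous_on_mult continuous_on_const
        continuous_on_product_coordinates)
  from continuous_attains_sup[OF comp ne this]
  obtain x where x: "I x x = 1" "\<And>y. y \<in> P \<inter> {x. I x x = 1} \<Longrightarrow> B y y \<le> B x x" by auto
  define \<mu> where "\<mu> = B x x"
  have max: "B y y \<le> \<mu> * I y y" for y
  proof (cases "I y y = 0")
    case True
    then have "y i = 0" if "i < n" for i
      using that by (simp add: Isq sum_nonneg_eq_0_iff)
    then have "B y y = 0" by (simp add: B_def)
    then show ?thesis using True by simp
  next
    case False
    then have pos: "I y y > 0" using I0[of y] by linarith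
    let ?z = "\<lambda>i. if i < n then y i / sqrt (I y y) else 0"
    have "B ?z ?z = (\<Sum>i<n. \<Sum>j<n. a i j * y i * y j / I y y)"
      unfolding B_def using pos by (intro sum.cong) auto
    also have "\<dots> = B y y / I y y" by (simp add: B_def sum_divide_distrib)
    finally have "B y y / I y y \<le> \<mu>" using x(2)[OF inS[OF False]] by (simp add: \<mu>_def)
    then show ?thesis using pos by (simp add: divide_le_eq)
  qed
  define r where "r i = (\<Sum>j<n. a i j * x j) - \<mu> * x i" for i
  have Bsym: "B y z = B z y" for y z
  proof -
    have "B y z = (\<Sum>j<n. \<Sum>i<n. a i j * y i * z j)" unfolding B_def by (rule sum.swap)
    also have "\<dots> = B z y" unfolding B_def
      by (intro sum.cong refl) (metis (no_types) sym mult.assoc mult.commute)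
    finally show ?thesis .
  qed
  have Brx: "B r x = I r r + \<mu> * I r x"
  proof -
    have "B r x = (\<Sum>i<n. r i * (\<Sum>j<n. a i j * x j))"
      by (simp add: B_def sum_distrib_left mult_ac)
    also have "\<dots> = (\<Sum>i<n. r i * (r i + \<mu> * x i))" by (simp add: r_def)
    also have "\<dots> = I r r + \<mu> * I r x"
      by (simp add: I_def distrib_left sum.distrib sum_distrib_left mult_ac)
    finally show ?thesis .
  qed
  have quad: "2 * t * I r r \<le> t\<^sup>2 * (\<mu> * I r r - B r r)" for t
  proof -
    let ?y = "\<lambda>i. x i + t * r i"
    have "B ?y ?y = B x x + t * B x r + t * B r x + t\<^sup>2 * B r r"
      by (simp add: B_def algebra_simps power2_eq_square sum.distrib sum_distrib_left)
    moreover have "I ?y ?y = I x x + 2 * t * I r x + t\<^sup>2 * I r r"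
      by (simp add: I_def algebra_simps power2_eq_square sum.distrib sum_distrib_left)
    ultimately show ?thesis
      using max[of ?y] x(1) Bsym[of x r] Brx by (simp add: \<mu>_def[symmetric] algebra_simps)
  qed
  have "I r r = 0"
  proof (rule ccontr)
    assume "I r r \<noteq> 0"
    then have pos: "I r r > 0" using I0[of r] by linarith
    define c where "c = \<bar>\<mu> * I r r - B r r\<bar> + 1"
    have c: "c > 0" "\<mu> * I r r - B r r < c" by (auto simp: c_def)
    \<comment> \<open>For this step length the quadratic bound is only half of the linear
      term.\<close>
    define t where "t = I r r / c"
    have t: "t > 0" using pos c by (simp add: t_def)
    have "2 * t * I r r \<le> t\<^sup>2 * c"
      using quad[of t] c(2) t by (smt (verit, best) mult_left_mono zero_le_power2)
    also have "\<dots> = t * I r r" using c by (simp add: t_def power2_eq_square)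
    finally show False using t pos by simp
  qed
  then have r0: "r i = 0" if "i < n" for i
    using that by (simp add: Isq sum_nonneg_eq_0_iff)
  show ?thesis
  proof (intro exI[of _ x] exI[of _ \<mu>] conjI allI impI)
    show "\<exists>i<n. x i \<noteq> 0" using x(1) by (auto simp: I_def intro: ccontr)
    show "(\<Sum>j<n. a i j * x j) = \<mu> * x i" if "i < n" for i using r0[OF that] by (simp add: r_def)
    show "(\<Sum>i<n. \<Sum>j<n. a i j * y i * y j) \<le> \<mu> * (\<Sum>i<n. (y i)\<^sup>2)" for y
      using max[of y] by (simp add: B_def Isq)
  qed
qed

lemma eigenvalue_mat_iff:
  fixes a :: "nat \<Rightarrow> nat \<Rightarrow> real"
  shows "eigenvalue (mat n n (\<lambda>(i, j). a i j)) \<mu> \<longleftrightarrow>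
    (\<exists>x. (\<exists>i<n. x i \<noteq> 0) \<and> (\<forall>i<n. (\<Sum>j<n. a i j * x j) = \<mu> * x i))"
    (is "?L \<longleftrightarrow> ?R")
proof
  assume ?L
  then obtain v where v: "v \<in> carrier_vec n" "v \<noteq> 0\<^sub>v n" "mat n n (\<lambda>(i, j). a i j) *\<^sub>v v = \<mu> \<cdot>\<^sub>v v"
    by (auto simp: eigenvalue_def eigenvector_def)
  have "\<exists>i<n. v $ i \<noteq> 0" using v(1,2) by (metis carrier_vecD dim_vec index_zero_vec eq_vecI)
  moreover have "(\<Sum>j<n. a i j * v $ j) = \<mu> * v $ i" if "i < n" for i
  proof -
    have "(mat n n (\<lambda>(i, j). a i j) *\<^sub>v v) $ i = (\<mu> \<cdot>\<^sub>v v) $ i" using v(3) by simp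
    then show ?thesis using v(1) that by (simp add: scalar_prod_def atLeast0LessThan)
  qed
  ultimately show ?R by blast
next
  assume ?R
  then obtain x where x: "\<exists>i<n. x i \<noteq> 0" "\<And>i. i < n \<Longrightarrow> (\<Sum>j<n. a i j * x j) = \<mu> * x i" by blast
  have "mat n n (\<lambda>(i, j). a i j) *\<^sub>v vec n x = \<mu> \<cdot>\<^sub>v vec n x"
    using x(2) by (intro eq_vecI) (auto simp: scalar_prod_def atLeast0LessThan)
  moreover have "vec n x \<noteq> 0\<^sub>v n" using x(1) by (metis index_vec index_zero_vec(1))
  ultimately show ?L unfolding eigenvalue_def eigenvector_def
    by (intro exI[of _ "vec n x"]) auto
qed

lemma finite_eigenvalues:
  fixes A :: "real mat"
  assumes "A \<in> carrier_mat n n"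
  shows "finite {x. eigenvalue A x}"
proof -
  have "char_poly A \<noteq> 0" using degree_monic_char_poly[OF assms] by auto
  then show ?thesis
    using poly_roots_finite[of "char_poly A"] by (simp add: eigenvalue_root_char_poly[OF assms])
qed

text \<open>The all-ones vector is inserted into the Rayleigh quotient.\<close>

lemma Max_eigenvalue_ge_average:
  fixes a :: "nat \<Rightarrow> nat \<Rightarrow> real"
  assumes n: "n > 0" and sym: "\<And>i j. a i j = a j i"
  shows "(\<Sum>i<n. \<Sum>j<n. a i j) \<le> real n * Max {x. eigenvalue (mat n n (\<lambda>(i, j). a i j)) x}"
proof -
  obtain x \<mu> where x: "\<exists>i<n. x i \<noteq> 0" "\<And>i. i < n \<Longrightarrow> (\<Sum>j<n. a i j * x j) = \<mu> * x i"
    and max: "\<And>y. (\<Sum>i<n. \<Sum>j<n. a i j * y i * y j) \<le> \<mu> * (\<Sum>i<n. (y i)\<^sup>2)"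
    using rayleigh_maximizer[of n a, OF n sym] by blast
  have "eigenvalue (mat n n (\<lambda>(i, j). a i j)) \<mu>"
    unfolding eigenvalue_mat_iff using x by blast
  then have "\<mu> \<le> Max {x. eigenvalue (mat n n (\<lambda>(i, j). a i j)) x}"
    using finite_eigenvalues[of "mat n n (\<lambda>(i, j). a i j)" n] by (intro Max_ge) auto
  then have "real n * \<mu> \<le> real n * Max {x. eigenvalue (mat n n (\<lambda>(i, j). a i j)) x}"
    by (intro mult_left_mono) auto
  then show ?thesis using max[of "\<lambda>_. 1"] by (simp add: mult.commute)
qed

text \<open>At the index where the ratio of \<open>\<bar>x i\<bar>\<close> to \<open>y i\<close> is
  largest, a single row of the eigenvalue equation bounds \<open>\<bar>\<mu>\<bar>\<close> by
  \<open>c\<close>.\<close>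

lemma Max_eigenvalue_le:
  fixes a :: "nat \<Rightarrow> nat \<Rightarrow> real"
  assumes n: "n > 0" and sym: "\<And>i j. a i j = a j i" and nonneg: "\<And>i j. a i j \<ge> 0"
    and y: "\<And>i. i < n \<Longrightarrow> y i > 0" "\<And>i. i < n \<Longrightarrow> (\<Sum>j<n. a i j * y j) \<le> c * y i"
  shows "Max {x. eigenvalue (mat n n (\<lambda>(i, j). a i j)) x} \<le> c"
proof (rule Max.boundedI)
  show "finite {x. eigenvalue (mat n n (\<lambda>(i, j). a i j)) x}"
    by (rule finite_eigenvalues[of _ n]) auto
  show "{x. eigenvalue (mat n n (\<lambda>(i, j). a i j)) x} \<noteq> {}"
    using rayleigh_maximizer[of n a, OF n sym] unfolding eigenvalue_mat_iff by blast
  fix \<mu> assume "\<mu> \<in> {x. eigenvalue (mat n n (\<lambda>(i, j). a i j)) x}"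
  then obtain x where x: "\<exists>i<n. x i \<noteq> 0" "\<And>i. i < n \<Longrightarrow> (\<Sum>j<n. a i j * x j) = \<mu> * x i"
    unfolding eigenvalue_mat_iff by auto
  define R where "R i = \<bar>x i\<bar> / y i" for i
  have "Max (R ` {..<n}) \<in> R ` {..<n}" using n by (intro Max_in) auto
  then obtain m where m: "m < n" "Max (R ` {..<n}) = R m" by auto
  have Rm: "\<bar>x i\<bar> \<le> R m * y i" if "i < n" for i
  proof -
    have "R i \<le> R m" unfolding m(2)[symmetric] using that by (intro Max_ge) auto
    then show ?thesis using y(1)[OF that] by (simp add: R_def divide_le_eq)
  qed
  have "R m > 0"
  proof -
    obtain i where "i < n" "x i \<noteq> 0" using x(1) by blast
    then have "0 < R m * y i" using Rm[of i] by linarith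
    then show ?thesis using y(1)[OF \<open>i < n\<close>] by (simp add: zero_less_mult_iff)
  qed
  have "\<bar>\<mu>\<bar> * \<bar>x m\<bar> = \<bar>\<Sum>j<n. a m j * x j\<bar>" using x(2)[OF m(1)] by (simp add: abs_mult)
  also have "\<dots> \<le> (\<Sum>j<n. \<bar>a m j * x j\<bar>)" by (rule sum_abs)
  also have "\<dots> \<le> (\<Sum>j<n. a m j * (R m * y j))"
    using Rm nonneg by (intro sum_mono) (auto simp: abs_mult intro: mult_left_mono)
  also have "\<dots> = R m * (\<Sum>j<n. a m j * y j)" by (simp add: sum_distrib_left mult_ac)
  also have "\<dots> \<le> R m * (c * y m)" using y(2)[OF m(1)] \<open>R m > 0\<close> by (intro mult_left_mono) auto
  also have "\<dots> = c * \<bar>x m\<bar>" using y(1)[OF m(1)] by (simp add: R_def)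
  finally have "\<bar>\<mu>\<bar> * \<bar>x m\<bar> \<le> c * \<bar>x m\<bar>" .
  moreover have "\<bar>x m\<bar> > 0" using \<open>R m > 0\<close> y(1)[OF m(1)] by (simp add: R_def zero_less_divide_iff)
  ultimately have "\<bar>\<mu>\<bar> \<le> c" by (simp add: mult_le_cancel_right)
  then show "\<mu> \<le> c" by linarith
qed

section \<open>A path of cocktail party graphs\<close>

text \<open>For even \<open>m\<close>, \<open>u div m\<close> is the block of \<open>u\<close>, and
  the pairs with equal \<open>u div 2\<close> are the perfect matching removed from it. Joining
  edges run from position 0 of a block to position 1 of the next, so the two attachment vertices of
  a block are themselves a removed pair; the weights below rely on this.\<close>

definition cocktail_path :: "nat \<Rightarrow> nat \<Rightarrow> nat \<Rightarrow> bool" where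
  "cocktail_path m u v \<longleftrightarrow> (u div m = v div m \<and> u div 2 \<noteq> v div 2) \<or>
     (m dvd u \<and> v = u + m + 1) \<or> (m dvd v \<and> u = v + m + 1)"

lemma sgraph_cocktail_path: "sgraph (cocktail_path m)"
  by (auto simp: sgraph_def cocktail_path_def intro!: sympI irreflpI)

lemma div2_block:
  fixes q r s :: nat
  shows "(q * (2 * s) + r) div 2 = q * s + r div 2"
  by (simp add: div_mult_self3 mult.left_commute[of q 2 s])

lemma div2_eq_distinct:
  fixes a b c :: nat
  assumes "a div 2 = b div 2" "a \<noteq> b" "a \<noteq> c" "b \<noteq> c"
  shows "c div 2 \<noteq> a div 2"
proof
  assume c: "c div 2 = a div 2"
  have eq: "u = v" if "u div 2 = v div 2" "even u \<longleftrightarrow> even v" for u v :: nat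
    using that by (metis bit_eq_rec)
  show False
    using eq[of a b] eq[of a c] eq[of b c] c assms by auto
qed

text \<open>The removed pairs are disjoint, so among three vertices of a block one is adjacent to
  both others. Hence a dissociation set meets each block in at most two vertices.\<close>

lemma cocktail_path_diss_le:
  assumes "m > 0"
  shows "diss_le (cocktail_path m) {0..<k * m} (2 * k)"
  unfolding diss_le_def
proof (intro allI impI)
  fix S assume S: "S \<subseteq> {0..<k * m}" "sparse (cocktail_path m) S"
  have fin: "finite S" using S(1) finite_subset by blast
  have "card {v \<in> S. v div m = i} \<le> 2" for i
  proof (rule ccontr)
    assume "\<not> ?thesis"
    then have "3 \<le> card {v \<in> S. v div m = i}" by simp
    then obtain T where T: "T \<subseteq> {v \<in> S. v div m = i}" "card T = 3"
      by (rule obtain_subset_with_card_n)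
    from T(2) obtain a b c where abc: "T = {a, b, c}" "a \<noteq> b" "a \<noteq> c" "b \<noteq> c"
      unfolding card_3_iff by blast
    have "\<exists>x y z. {x, y, z} \<subseteq> T \<and> y \<noteq> z \<and> x div 2 \<noteq> y div 2 \<and> x div 2 \<noteq> z div 2"
    proof -
      consider "a div 2 = b div 2" | "a div 2 = c div 2" | "a div 2 \<noteq> b div 2" "a div 2 \<noteq> c div 2"
        by blast
      then show ?thesis
      proof cases
        case 1
        then have "c div 2 \<noteq> a div 2" using div2_eq_distinct abc by blast
        then show ?thesis using 1 abc by (intro exI[of _ c] exI[of _ a] exI[of _ b]) simp
      next
        case 2
        then have "b div 2 \<noteq> a div 2" using div2_eq_distinct abc by metis
        then show ?thesis using 2 abc by (intro exI[of _ b] exI[of _ a] exI[of _ c]) simp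
      next
        case 3
        then show ?thesis using abc by (intro exI[of _ a] exI[of _ b] exI[of _ c]) simp
      qed
    qed
    then obtain x y z where xyz: "{x, y, z} \<subseteq> T" "y \<noteq> z" "x div 2 \<noteq> y div 2" "x div 2 \<noteq> z div 2"
      by blast
    have "{y, z} \<subseteq> nbrs (cocktail_path m) S x"
      using xyz T(1) by (auto simp: nbrs_def cocktail_path_def)
    then have "card {y, z} \<le> card (nbrs (cocktail_path m) S x)"
      using fin by (intro card_mono) auto
    moreover have "card (nbrs (cocktail_path m) S x) \<le> 1"
      using S(2) xyz(1) T(1) by (auto simp: sparse_def)
    ultimately show False using xyz(2) by simp
  qed
  then have "(\<Sum>i<k. card {v \<in> S. v div m = i}) \<le> (\<Sum>i<k. 2)" by (intro sum_mono)
  moreover have "v div m < k" if "v \<in> S" for v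
    using S(1) that by (auto simp: less_mult_imp_div_less)
  ultimately show "card S \<le> 2 * k"
    using sum_card_classes[OF fin, of "\<lambda>v. v div m" k] by simp
qed

text \<open>Positions 2 and 3 of every block are a removed pair and avoid the attachment vertices 0
  and 1, so together they are an independent set.\<close>

lemma cocktail_path_sparse_set:
  assumes "s \<ge> 2"
  shows "\<exists>S \<subseteq> {0..<k * (2 * s)}. sparse (cocktail_path (2 * s)) S \<and> card S = 2 * k"
proof -
  define A where "A r = (\<lambda>q. q * (2 * s) + r) ` {..<k}" for r
  have le: "q * (2 * s) + r < k * (2 * s)" if "q < k" "r < 2 * s" for q r
  proof -
    have "q * (2 * s) + r < (q + 1) * (2 * s)" using that by simp
    also have "\<dots> \<le> k * (2 * s)" using that by (intro mult_right_mono) auto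
    finally show ?thesis .
  qed
  have inj: "inj_on (\<lambda>q. q * (2 * s) + r) {..<k}" for r
    using assms by (auto intro: inj_onI)
  have cA: "card (A r) = k" for r unfolding A_def using inj by (simp add: card_image)
  have finA: "finite (A r)" for r by (simp add: A_def)
  have disj: "A 2 \<inter> A 3 = {}"
  proof -
    have "even x" if "x \<in> A 2" for x using that by (auto simp: A_def)
    moreover have "odd x" if "x \<in> A 3" for x using that by (auto simp: A_def)
    ultimately show ?thesis by blast
  qed
  have "card (A 2 \<union> A 3) = 2 * k"
    using cA disj by (simp add: card_Un_disjoint finA)
  moreover have "A 2 \<union> A 3 \<subseteq> {0..<k * (2 * s)}"
    using le[of _ 2] le[of _ 3] assms by (auto simp: A_def)
  moreover have "sparse (cocktail_path (2 * s)) (A 2 \<union> A 3)"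
  proof -
    have rep: "\<exists>q. x div (2 * s) = q \<and> x div 2 = q * s + 1 \<and> \<not> 2 * s dvd x" if "x \<in> A 2 \<union> A 3" for x
    proof -
      from that obtain q r where q: "x = q * (2 * s) + r" "r = 2 \<or> r = 3"
        unfolding A_def by blast
      have "x div 2 = q * s + 1" unfolding q(1) div2_block using q(2) by auto
      moreover have "x div (2 * s) = q" using q assms by auto
      moreover have "x mod (2 * s) = r" using q assms by auto
      then have "\<not> 2 * s dvd x" using q(2) by (auto simp: dvd_eq_mod_eq_0)
      ultimately show ?thesis by blast
    qed
    have "\<not> cocktail_path (2 * s) x y" if "x \<in> A 2 \<union> A 3" "y \<in> A 2 \<union> A 3" for x y
      using rep[OF that(1)] rep[OF that(2)] by (auto simp: cocktail_path_def)
    then have "nbrs (cocktail_path (2 * s)) (A 2 \<union> A 3) x = {}" if "x \<in> A 2 \<union> A 3" for x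
      using that by (auto simp: nbrs_def)
    then show ?thesis by (simp add: sparse_def)
  qed
  ultimately show ?thesis by blast
qed

lemma cocktail_path_cut:
  assumes s: "s \<ge> 2" and U: "U \<subseteq> {0..<k * (2 * s)}" "U \<noteq> {}" "U \<noteq> {0..<k * (2 * s)}"
  shows "\<exists>u\<in>U. \<exists>v\<in>{0..<k * (2 * s)} - U. cocktail_path (2 * s) u v"
proof (rule ccontr)
  assume no: "\<not> ?thesis"
  define n where "n = k * (2 * s)"
  have inv: "u \<in> U \<longleftrightarrow> v \<in> U" if "u < n" "v < n" "cocktail_path (2 * s) u v" for u v
  proof -
    have closed: "y \<in> U" if "x \<in> U" "y < n" "cocktail_path (2 * s) x y" for x y
      using no that unfolding n_def by force
    show ?thesis
      using closed[of u v] closed[of v u] that sgraph_sym[OF sgraph_cocktail_path, of "2 * s" u v] by blast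
  qed
  have le: "q * (2 * s) + r < n" if "q < k" "r < 2 * s" for q r
  proof -
    have "q * (2 * s) + r < (q + 1) * (2 * s)" using that by simp
    also have "\<dots> \<le> k * (2 * s)" using that by (intro mult_right_mono) auto
    finally show ?thesis by (simp add: n_def)
  qed
  have adj: "cocktail_path (2 * s) (q * (2 * s) + r) (q * (2 * s) + r')"
    if "r < 2 * s" "r' < 2 * s" "r div 2 \<noteq> r' div 2" for q r r'
    using that unfolding cocktail_path_def div2_block by auto
  have block: "q * (2 * s) + r \<in> U \<longleftrightarrow> q * (2 * s) \<in> U" if "q < k" "r < 2 * s" for q r
  proof -
    have far: "q * (2 * s) + r \<in> U \<longleftrightarrow> q * (2 * s) \<in> U" if "2 \<le> r" "r < 2 * s" for r
      using inv[of "q * (2 * s) + r" "q * (2 * s) + 0"] le[of q r] le[of q 0] adj[of r 0 q] that \<open>q < k\<close>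
      by auto
    \<comment> \<open>Positions 0 and 1 are not adjacent; position 2, present because
      \<open>s \<ge> 2\<close>, links them.\<close>
    have "q * (2 * s) + 1 \<in> U \<longleftrightarrow> q * (2 * s) + 2 \<in> U"
      using inv[of "q * (2 * s) + 1" "q * (2 * s) + 2"] le[of q 1] le[of q 2] adj[of 1 2 q] \<open>q < k\<close> s
      by auto
    then have one: "q * (2 * s) + 1 \<in> U \<longleftrightarrow> q * (2 * s) \<in> U" using far[of 2] s by simp
    consider "r = 0" | "r = 1" | "2 \<le> r" by linarith
    then show ?thesis
    proof cases
      case 3
      then show ?thesis using far that(2) by blast
    qed (use one in simp_all)
  qed
  have start: "q * (2 * s) \<in> U \<longleftrightarrow> 0 \<in> U" if "q < k" for q
    using that
  proof (induction q)
    case (Suc q)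
    have "cocktail_path (2 * s) (q * (2 * s)) (Suc q * (2 * s) + 1)"
      by (auto simp: cocktail_path_def)
    then have "q * (2 * s) \<in> U \<longleftrightarrow> Suc q * (2 * s) + 1 \<in> U"
      using inv le[of q 0] le[of "Suc q" 1] Suc.prems s by auto
    then show ?case using block[of "Suc q" 1] Suc s by simp
  qed simp
  have all: "v \<in> U \<longleftrightarrow> 0 \<in> U" if "v < n" for v
  proof -
    have "v div (2 * s) < k" using that by (simp add: n_def less_mult_imp_div_less)
    moreover have "v mod (2 * s) < 2 * s" using s by simp
    ultimately show ?thesis
      using block[of "v div (2 * s)" "v mod (2 * s)"] start[of "v div (2 * s)"]
      by (simp only: div_mult_mod_eq)
  qed
  obtain v where "v \<in> U" using U(2) by blast
  then have "0 \<in> U" using all U(1) by (auto simp: n_def)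
  then have "{0..<n} \<subseteq> U" using all by auto
  then show False using U(1,3) by (simp add: n_def)
qed

text \<open>
  The weights \<open>(q + 1) (k - q)\<close> on the blocks vanish just outside the path of blocks and have
  constant second difference \<open>-2\<close>. As they are at most \<open>k\<^sup>2\<close>, the two weights next to a block add up
  to at most \<open>2 - 1 / k\<^sup>2\<close> times its own weight; constant weights would only give the factor \<open>2\<close>,
  which is not enough for a strict bound.
\<close>

lemma cocktail_path_weights:
  fixes k s :: nat
  assumes k: "k > 0" and s: "s \<ge> 2"
  defines "m \<equiv> 2 * s" and "n \<equiv> k * (2 * s)"
  shows "\<exists>y. (\<forall>i<n. y i > 0) \<and> (\<forall>i<n. (\<Sum>j<n. (if cocktail_path m i j then 1 else 0) * y j) \<le>
    (real m - 2 + (2 - 1 / real k ^ 2) / (real m - 2)) * y i)"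
proof -
  \<comment> \<open>A function on the reals, so that it can be evaluated at \<open>-1\<close>, just
    before the first block, where it vanishes.\<close>
  define W where "W x = (x + 1) * (real k - x)" for x :: real
  define c where "c = 1 / (real m - 2)"
  define \<delta> where "\<delta> = c * (2 - 1 / real k ^ 2)"
  have m4: "real m \<ge> 4" "m \<ge> 4" using s by (auto simp: m_def)
  have c: "c > 0" "(real m - 2) * c = 1" using m4 by (auto simp: c_def)
  have Wk: "W q \<le> real k ^ 2" "W q > 0" if "q < k" for q :: nat
  proof -
    have "(real q + 1) * (real k - q) \<le> real k * real k"
      using that by (intro mult_mono) auto
    then show "W q \<le> real k ^ 2" by (simp add: W_def power2_eq_square)
    show "W q > 0" using that by (simp add: W_def)
  qed
  have W0: "W (real q + 1) \<ge> 0" "W (real q - 1) \<ge> 0" if "q < k" for q :: nat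
    using that by (auto simp: W_def)
  have \<delta>: "\<delta> \<ge> c"
  proof -
    have "1 / real k ^ 2 \<le> 1" using k by (simp add: divide_le_eq)
    then have "c * 1 \<le> \<delta>" unfolding \<delta>_def using c by (intro mult_left_mono) auto
    then show ?thesis by simp
  qed
  \<comment> \<open>The attachment vertices have one extra neighbour each, position 0 in block
    \<open>q + 1\<close> and position 1 in block \<open>q - 1\<close>. Each is raised by the weight
    of that block divided by \<open>m - 2\<close>, so that \<open>m - 2\<close> times the raise pays
    for the extra neighbour.\<close>
  define Y where "Y q r = W (real q) + (if r = 0 then c * W (real q + 1) else 0) +
      (if r = 1 then c * W (real q - 1) else 0)" for q r :: nat
  define y where "y v = Y (v div m) (v mod m)" for v
  have Y0: "Y q r > 0" if "q < k" for q r
    using Wk(2)[OF that] W0[OF that] c unfolding Y_def by (intro add_pos_nonneg) auto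
  have nm: "n = k * m" by (simp add: n_def m_def)
  have qk: "v div m < k" if "v < n" for v using that by (simp add: nm less_mult_imp_div_less)
  have mod1: "(j + m + 1) mod m = 1" if j: "m dvd j" for j
  proof -
    obtain l where "j = m * l" using j by (rule dvdE)
    then have "(j + m + 1) mod m = (1 + (l + 1) * m) mod m" by (simp add: algebra_simps)
    also have "\<dots> = 1 mod m" by (rule mod_mult_self1)
    finally show ?thesis using m4 by simp
  qed
  have y0: "y v > 0" if "v < n" for v using Y0[OF qk[OF that]] by (simp add: y_def)
  have yb: "y (q * m + r) = Y q r" if "r < m" for q r using that m4 by (simp add: y_def)
  have "(\<Sum>j<n. (if cocktail_path m i j then 1 else 0) * y j) \<le> (real m - 2 + \<delta>) * y i" if i: "i < n" for i
  proof -
    define q r where "q = i div m" and "r = i mod m"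
    have q: "q < k" and r: "r < m" using qk[OF i] m4 by (auto simp: q_def r_def)
    have iqr: "i = q * m + r" by (simp add: q_def r_def)
    \<comment> \<open>The neighbours of \<open>i\<close> lie in its block \<open>L\<close> without
      its own pair \<open>P\<close>, or in the set \<open>B\<close> of endpoints of joining
      edges.\<close>
    define P where "P = {2 * (i div 2), 2 * (i div 2) + 1}"
    define B where "B = {j. j < n \<and> ((m dvd i \<and> j = i + m + 1) \<or> (m dvd j \<and> i = j + m + 1))}"
    define L where "L = {q * m..<q * m + m}"
    have L: "j \<in> L \<longleftrightarrow> j div m = q" for j
    proof
      assume "j \<in> L"
      then show "j div m = q" by (intro div_nat_eqI) (auto simp: L_def mult.commute)
    next
      assume "j div m = q"
      then have "j = q * m + j mod m" using div_mult_mod_eq[of j m] by simp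
      moreover have "j mod m < m" using m4 by simp
      ultimately show "j \<in> L" unfolding L_def by (metis atLeastLessThan_iff add_less_cancel_left le_add1)
    qed
    have Ln: "L \<subseteq> {..<n}"
    proof -
      have "(q + 1) * m \<le> n" unfolding nm using q by (intro mult_right_mono) auto
      then show ?thesis by (auto simp: L_def)
    qed
    have "r div 2 < s" using r by (simp add: m_def div_less_iff_less_mult mult.commute)
    then have rr: "2 * (r div 2) + 1 < m" by (simp add: m_def)
    have PL: "P = {q * m + 2 * (r div 2), q * m + 2 * (r div 2) + 1}" "P \<subseteq> L"
    proof -
      have "i div 2 = q * s + r div 2" unfolding iqr m_def by (rule div2_block)
      then show P: "P = {q * m + 2 * (r div 2), q * m + 2 * (r div 2) + 1}"
        by (simp add: P_def m_def mult.left_commute)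
      show "P \<subseteq> L" unfolding P L_def using rr by auto
    qed
    have "(\<Sum>j<n. (if cocktail_path m i j then 1 else 0) * y j) = sum y {j \<in> {..<n}. cocktail_path m i j}"
      by (subst sum.inter_filter) (auto intro!: sum.cong)
    also have "\<dots> \<le> sum y ((L - P) \<union> B)"
    proof (rule sum_mono2)
      show "finite (L - P \<union> B)" by (auto simp: L_def B_def)
      have iffP: "j \<in> P \<longleftrightarrow> j div 2 = i div 2" for j unfolding P_def by auto
      show "{j \<in> {..<n}. cocktail_path m i j} \<subseteq> L - P \<union> B"
      proof
        fix j assume j: "j \<in> {j \<in> {..<n}. cocktail_path m i j}"
        show "j \<in> L - P \<union> B"
        proof (cases "i div m = j div m \<and> i div 2 \<noteq> j div 2")
          case True
          then show ?thesis using L[of j] iffP[of j] by (simp add: q_def)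
        next
          case False
          then show ?thesis using j unfolding cocktail_path_def B_def by blast
        qed
      qed
      show "0 \<le> y b" if "b \<in> (L - P \<union> B) - {j \<in> {..<n}. cocktail_path m i j}" for b
      proof -
        have "b < n" using that Ln unfolding B_def by blast
        then show ?thesis using y0 by (simp add: less_imp_le)
      qed
    qed
    also have "\<dots> \<le> sum y (L - P) + sum y B"
    proof -
      have "sum y ((L - P) \<union> B) + sum y ((L - P) \<inter> B) = sum y (L - P) + sum y B"
        by (rule sum.union_inter) (auto simp: L_def B_def)
      moreover have "sum y ((L - P) \<inter> B) \<ge> 0"
        using y0 by (intro sum_nonneg less_imp_le) (auto simp: B_def)
      ultimately show ?thesis by linarith
    qed
    also have "sum y (L - P) = sum y L - sum y P"
      using PL(2) by (simp add: sum_diff L_def)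
    also have "sum y L = m * W q + c * (W (real q + 1) + W (real q - 1))"
    proof -
      have "sum y L = (\<Sum>r<m. y (q * m + r))"
        unfolding L_def using sum.shift_bounds_nat_ivl[of y 0 "q * m" m]
        by (simp add: atLeast0LessThan add.commute)
      also have "\<dots> = (\<Sum>r<m. Y q r)" using yb by (intro sum.cong) auto
      also have "\<dots> = m * W q + c * (W (real q + 1) + W (real q - 1))"
        using m4 by (simp add: Y_def sum.distrib distrib_left)
      finally show ?thesis .
    qed
    finally have main: "(\<Sum>j<n. (if cocktail_path m i j then 1 else 0) * y j) \<le>
      m * W q + c * (W (real q + 1) + W (real q - 1)) - sum y P + sum y B" by simp
    have sumP: "sum y P = Y q (2 * (r div 2)) + Y q (2 * (r div 2) + 1)"
      using rr yb[of "2 * (r div 2)" q] yb[of "2 * (r div 2) + 1" q] by (simp add: PL(1) add.assoc)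
    consider (out) "r = 0" | (inn) "r = 1" | (bulk) "r \<ge> 2" by linarith
    then show ?thesis
    proof cases
      \<comment> \<open>Positions 0 and 1 form the pair \<open>P\<close>, so both raises drop out of
        the block sum. The raise at \<open>i\<close> covers the main weight of the extra neighbour,
        and \<open>c \<le> \<delta>\<close> covers the raise of that neighbour.\<close>
      case out
      have "B \<subseteq> {i + m + 1}" 
      proof
        fix j assume j: "j \<in> B"
        have "i \<noteq> j + m + 1" if "m dvd j"
        proof
          assume "i = j + m + 1"
          moreover have "i mod m = 0" using out by (simp add: r_def)
          ultimately have "(j + m + 1) mod m = 0" by simp
          moreover have "(j + m + 1) mod m = 1" using mod1[OF that] .
          ultimately show False by simp
        qed
        then show "j \<in> {i + m + 1}" using j by (auto simp: B_def)
      qed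
      then have "sum y B \<le> W (real q + 1) + c * W q"
      proof (cases "i + m + 1 \<in> B")
        case True
        have "i + m + 1 = (q + 1) * m + 1" using iqr out by simp
        then have "y (i + m + 1) = Y (q + 1) 1" using yb[of 1 "q + 1"] m4 by (simp add: add_ac)
        moreover have "B = {i + m + 1}" using True \<open>B \<subseteq> {i + m + 1}\<close> by blast
        ultimately show ?thesis by (simp add: Y_def add.commute)
      next
        case False
        then have "B = {}" using \<open>B \<subseteq> {i + m + 1}\<close> by blast
        then show ?thesis using W0[OF q] Wk(2)[OF q] c by simp
      qed
      moreover have "sum y P = 2 * W q + c * (W (real q + 1) + W (real q - 1))"
        unfolding sumP using out by (simp add: Y_def distrib_left)
      moreover have "y i = W q + c * W (real q + 1)" using out by (simp add: y_def q_def[symmetric] r_def[symmetric] Y_def)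
      moreover have "c * W q \<le> \<delta> * W q" using \<delta> Wk(2)[OF q] by (intro mult_right_mono) auto
      moreover have "0 \<le> \<delta> * (c * W (real q + 1))" using \<delta> c W0[OF q] by auto
      moreover have "(real m - 2) * (c * W (real q + 1)) = W (real q + 1)" using c(2) by (metis mult.assoc mult_1)
      ultimately show ?thesis using main by (simp add: algebra_simps)
    next
      case inn
      have "j = i - m - 1 \<and> m dvd j \<and> i = j + m + 1" if "j \<in> B" for j
      proof -
        have "\<not> m dvd i" using inn by (simp add: r_def dvd_eq_mod_eq_0)
        then show ?thesis using that by (auto simp: B_def)
      qed
      then have B: "B \<subseteq> {i - m - 1}" and Bi: "i - m - 1 \<in> B \<Longrightarrow> m dvd (i - m - 1) \<and> i = i - m - 1 + m + 1"
        by blast+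
      have "sum y B \<le> W (real q - 1) + c * W q"
      proof (cases "i - m - 1 \<in> B")
        case True
        then obtain p where p: "i - m - 1 = p * m" "i = p * m + m + 1" using Bi by (metis dvd_def mult.commute)
        have "q * m + 1 = (p + 1) * m + 1" using p(2) iqr inn by simp
        then have qp: "q = p + 1" using m4 by (metis add_right_cancel mult_right_cancel not_numeral_le_zero)
        have "y (p * m) = Y p 0" using yb[of 0 p] m4 by simp
        moreover have "B = {p * m}" using True B p(1) by auto
        ultimately show ?thesis by (simp add: Y_def qp add.commute)
      next
        case False
        then have "B = {}" using B by blast
        then show ?thesis using W0[OF q] Wk(2)[OF q] c by simp
      qed
      moreover have "sum y P = 2 * W q + c * (W (real q + 1) + W (real q - 1))"
        unfolding sumP using inn by (simp add: Y_def distrib_left)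
      moreover have "y i = W q + c * W (real q - 1)" using inn by (simp add: y_def q_def[symmetric] r_def[symmetric] Y_def)
      moreover have "c * W q \<le> \<delta> * W q" using \<delta> Wk(2)[OF q] by (intro mult_right_mono) auto
      moreover have "0 \<le> \<delta> * (c * W (real q - 1))" using \<delta> c W0[OF q] by auto
      moreover have "(real m - 2) * (c * W (real q - 1)) = W (real q - 1)" using c(2) by (metis mult.assoc mult_1)
      ultimately show ?thesis using main by (simp add: algebra_simps)
    next
      \<comment> \<open>An unattached vertex sees both raises of its block; here the full size of
        \<delta> is used.\<close>
      case bulk
      have "B = {}"
      proof -
        have "i \<noteq> j + m + 1" if "m dvd j" for j using mod1[OF that] bulk by (force simp: r_def)
        moreover have "\<not> m dvd i" using bulk by (simp add: r_def dvd_eq_mod_eq_0)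
        ultimately show ?thesis by (auto simp: B_def)
      qed
      moreover have "sum y P = 2 * W q"
        unfolding sumP using bulk by (auto simp: Y_def)
      moreover have "y i = W q" using bulk by (simp add: y_def q_def[symmetric] r_def[symmetric] Y_def)
      moreover have "c * (W (real q + 1) + W (real q - 1)) \<le> \<delta> * W q"
      proof -
        have "W q / real k ^ 2 \<le> 1" using Wk(1)[OF q] k by (simp add: divide_le_eq)
        have "W (real q + 1) + W (real q - 1) = 2 * W q - 2" by (simp add: W_def algebra_simps)
        also have "\<dots> \<le> 2 * W q - W q / real k ^ 2"
          using \<open>W q / real k ^ 2 \<le> 1\<close> by simp
        finally have "c * (W (real q + 1) + W (real q - 1)) \<le> c * (2 * W q - W q / real k ^ 2)"
          using c by (intro mult_left_mono) auto
        then show ?thesis by (simp add: \<delta>_def algebra_simps)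
      qed
      ultimately show ?thesis using main by (simp add: algebra_simps)
    qed
  qed
  then show ?thesis using y0 by (intro exI[of _ y]) (auto simp: \<delta>_def c_def)
qed

section \<open>Graphs as pair digraphs\<close>

abbreviation adj :: "'a pair_pre_digraph \<Rightarrow> 'a \<Rightarrow> 'a \<Rightarrow> bool" where
  "adj G u v \<equiv> (u, v) \<in> parcs G"

lemma pair_graph_iff:
  "pair_graph G \<longleftrightarrow> finite (pverts G) \<and> parcs G \<subseteq> pverts G \<times> pverts G \<and> sgraph (adj G)"
proof
  assume "pair_graph G"
  then interpret pair_graph G .
  have "sgraph (adj G)"
    using pair_sym_arcs no_loops' unfolding sgraph_def symmetric_def
    by (auto intro!: sympI irreflpI dest: symD)
  then show "finite (pverts G) \<and> parcs G \<subseteq> pverts G \<times> pverts G \<and> sgraph (adj G)"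
    using pair_finite_verts in_arcsD1 in_arcsD2 by auto
next
  assume *: "finite (pverts G) \<and> parcs G \<subseteq> pverts G \<times> pverts G \<and> sgraph (adj G)"
  then have "finite (parcs G)" using finite_subset by blast
  then show "pair_graph G"
    using * by unfold_locales
      (auto simp: symmetric_def sgraph_def intro!: symI dest: sympD irreflpD)
qed

lemma dissociation_set_iff:
  "dissociation_set G S \<longleftrightarrow> S \<subseteq> pverts G \<and> sparse (adj G) S"
proof -
  have "out_degree (induce_subgraph (with_proj G) S) v = card (nbrs (adj G) S v)" if "v \<in> S" for v
  proof -
    have "out_arcs (induce_subgraph (with_proj G) S) v = Pair v ` nbrs (adj G) S v"
      using that by (auto simp: out_arcs_def nbrs_def induce_subgraph_def)
    then show ?thesis by (simp add: out_degree_def card_image inj_on_def)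
  qed
  then show ?thesis by (auto simp: dissociation_set_def sparse_def)
qed

lemma finite_dissociation_cards:
  assumes "finite (pverts G)"
  shows "finite (card ` {S. dissociation_set G S})"
proof -
  have "{S. dissociation_set G S} \<subseteq> Pow (pverts G)" by (auto simp: dissociation_set_iff)
  then show ?thesis using assms by (meson finite_Pow_iff finite_imageI finite_subset)
qed

lemma diss_le_dissociation_number:
  assumes "finite (pverts G)"
  shows "diss_le (adj G) (pverts G) (dissociation_number G)"
  unfolding diss_le_def dissociation_number_def
  by (auto simp: dissociation_set_iff intro!: Max_ge[OF finite_dissociation_cards[OF assms]])

lemma dissociation_number_eqI:
  assumes "finite (pverts G)" "diss_le (adj G) (pverts G) d"
    and "S \<subseteq> pverts G" "sparse (adj G) S" "card S = d"
  shows "dissociation_number G = d"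
  unfolding dissociation_number_def
proof (rule Max_eqI[OF finite_dissociation_cards[OF assms(1)]])
  show "d \<in> card ` {S. dissociation_set G S}" using assms(3-5) by (auto simp: dissociation_set_iff)
qed (use assms(2) in \<open>auto simp: dissociation_set_iff diss_le_def\<close>)

text \<open>Reachability is replaced by the cut condition, the form in which connectedness is used
  for counting crossing edges and checked for the test graph. For the converse, the set reachable
  from a vertex has no outgoing edge.\<close>

lemma connected_iff_cut:
  assumes "pair_graph G"
  shows "Digraph_Component.connected (with_proj G) \<longleftrightarrow> pverts G \<noteq> {} \<and>
    (\<forall>U\<subseteq>pverts G. U \<noteq> {} \<longrightarrow> U \<noteq> pverts G \<longrightarrow> (\<exists>u\<in>U. \<exists>v\<in>pverts G - U. adj G u v))"
proof -
  have G: "parcs G \<subseteq> pverts G \<times> pverts G" "sgraph (adj G)" using assms by (simp_all add: pair_graph_iff)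
  have "(parcs G)\<^sup>s = parcs G"
    using sgraph_sym[OF G(2)] by (auto simp: symcl_def)
  then have conn: "Digraph_Component.connected (with_proj G) \<longleftrightarrow> pverts G \<noteq> {} \<and>
      (\<forall>u\<in>pverts G. \<forall>v\<in>pverts G. (u, v) \<in> rtrancl_on (pverts G) (parcs G))"
    by (simp add: connected_conv)
  show ?thesis
  proof
    assume c: "Digraph_Component.connected (with_proj G)"
    have "\<exists>u\<in>U. \<exists>v\<in>pverts G - U. adj G u v" if U: "U \<subseteq> pverts G" "U \<noteq> {}" "U \<noteq> pverts G" for U
    proof (rule ccontr)
      assume no: "\<not> ?thesis"
      obtain a b where ab: "a \<in> U" "b \<in> pverts G - U" using U by blast
      then have "(a, b) \<in> rtrancl_on (pverts G) (parcs G)" using c conn U by blast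
      then have "b \<in> U"
        using ab(1) by (induction rule: rtrancl_on.induct) (use no in blast)+
      then show False using ab(2) by blast
    qed
    then show "pverts G \<noteq> {} \<and>
        (\<forall>U\<subseteq>pverts G. U \<noteq> {} \<longrightarrow> U \<noteq> pverts G \<longrightarrow> (\<exists>u\<in>U. \<exists>v\<in>pverts G - U. adj G u v))"
      using c conn by blast
  next
    assume *: "pverts G \<noteq> {} \<and>
        (\<forall>U\<subseteq>pverts G. U \<noteq> {} \<longrightarrow> U \<noteq> pverts G \<longrightarrow> (\<exists>u\<in>U. \<exists>v\<in>pverts G - U. adj G u v))"
    have "(a, b) \<in> rtrancl_on (pverts G) (parcs G)" if "a \<in> pverts G" "b \<in> pverts G" for a b
    proof -
      define U where "U = {v \<in> pverts G. (a, v) \<in> rtrancl_on (pverts G) (parcs G)}"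
      have "a \<in> U" using that by (auto simp: U_def)
      moreover have "v \<in> U" if "u \<in> U" "v \<in> pverts G" "adj G u v" for u v
        using that unfolding U_def by (auto intro: rtrancl_on_into_rtrancl_on)
      ultimately have "U = pverts G" using * unfolding U_def by blast
      then show ?thesis using that by (auto simp: U_def)
    qed
    then show "Digraph_Component.connected (with_proj G)" using * conn by blast
  qed
qed

lemma double_num_edges:
  assumes "pair_graph G"
  shows "2 * num_edges G = arc_count (adj G) (pverts G)"
proof -
  have G: "finite (pverts G)" "parcs G \<subseteq> pverts G \<times> pverts G" "sgraph (adj G)"
    using assms by (simp_all add: pair_graph_iff)
  have fin: "finite (parcs G)" using G(1,2) finite_subset by blast
  define \<phi> where "\<phi> = (\<lambda>(u :: 'a, v). {u, v})"
  have im: "edge_set G = \<phi> ` parcs G" by (auto simp: edge_set_def \<phi>_def)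
  have fibre: "card {a \<in> parcs G. \<phi> a = e} = 2" if e: "e \<in> edge_set G" for e
  proof -
    obtain u v where uv: "e = {u, v}" "(u, v) \<in> parcs G" using e unfolding edge_set_def by blast
    then have "(v, u) \<in> parcs G" "u \<noteq> v" using sgraph_sym[OF G(3)] sgraph_irrefl[OF G(3)] by blast+
    then have "{a \<in> parcs G. \<phi> a = e} = {(u, v), (v, u)}"
      using uv by (auto simp: \<phi>_def doubleton_eq_iff)
    then show ?thesis using \<open>u \<noteq> v\<close> by simp
  qed
  have "card (parcs G) = (\<Sum>e\<in>edge_set G. card {a \<in> parcs G. \<phi> a = e})"
    using sum.image_gen[OF fin, of "\<lambda>_. 1::nat" \<phi>] im by simp
  also have "\<dots> = 2 * num_edges G" using fibre by (simp add: num_edges_def)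
  finally have "card (parcs G) = 2 * num_edges G" .
  moreover have "parcs G = (SIGMA v:pverts G. nbrs (adj G) (pverts G) v)"
    using G(2) by (auto simp: nbrs_def)
  then have "card (parcs G) = arc_count (adj G) (pverts G)"
    using G(1) unfolding arc_count_def by (metis card_SigmaI finite_nbrs)
  ultimately show ?thesis by simp
qed

section \<open>The average-degree bound and the test graph\<close>

lemma spectral_radius_ge_average:
  assumes "pair_graph G" "pverts G = {0..<n}" "n > 0"
  shows "real (arc_count (adj G) (pverts G)) \<le> n * graph_spectral_radius G"
proof -
  have sym: "adj G i j \<longleftrightarrow> adj G j i" for i j
    using assms(1) sgraph_sym[of "adj G"] by (simp add: pair_graph_iff)
  have "real (card (nbrs (adj G) {0..<n} i)) = (\<Sum>j<n. if adj G i j then 1 else 0)" for i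
    by (simp add: nbrs_def sum.If_cases Int_def atLeast0LessThan)
  then have "real (arc_count (adj G) (pverts G)) = (\<Sum>i<n. \<Sum>j<n. if adj G i j then 1 else 0)"
    by (simp add: arc_count_def assms(2) atLeast0LessThan)
  also have "\<dots> \<le> n * graph_spectral_radius G"
    using Max_eigenvalue_ge_average[OF assms(3), of "\<lambda>i j. if adj G i j then 1 else 0"] sym
    by (simp add: graph_spectral_radius_def adjacency_matrix_def assms(2))
  finally show ?thesis .
qed

text \<open>The relation is cut off at \<open>k * m\<close>, since it would also join the last block
  to a vertex beyond the range.\<close>

definition cocktail_path_graph :: "nat \<Rightarrow> nat \<Rightarrow> nat pair_pre_digraph" where
  "cocktail_path_graph k m =
     \<lparr>pverts = {0..<k * m}, parcs = {(u, v). u < k * m \<and> v < k * m \<and> cocktail_path m u v}\<rparr>"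

lemma cocktail_path_graph_mem:
  assumes "k > 0" "s \<ge> 2"
  shows "cocktail_path_graph k (2 * s) \<in> connected_graphs_diss (k * (2 * s)) (2 * k)"
proof -
  let ?G = "cocktail_path_graph k (2 * s)" and ?E = "cocktail_path (2 * s)" and ?V = "{0..<k * (2 * s)}"
  have V: "pverts ?G = ?V" by (simp add: cocktail_path_graph_def)
  have E: "adj ?G u v \<longleftrightarrow> u \<in> ?V \<and> v \<in> ?V \<and> ?E u v" for u v
    by (simp add: cocktail_path_graph_def)
  have pg: "pair_graph ?G"
    unfolding pair_graph_iff V
  proof (intro conjI)
    show "parcs ?G \<subseteq> ?V \<times> ?V" using E by (intro subrelI) blast
    have "?E u v \<longleftrightarrow> ?E v u" "\<not> ?E u u" for u v
      using sgraph_cocktail_path[of "2 * s"] by (rule sgraph_sym, rule sgraph_irrefl)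
    then show "sgraph (adj ?G)"
      unfolding sgraph_def E by (blast intro: sympI irreflpI)
  qed simp
  have nb: "nbrs (adj ?G) S v = nbrs ?E S v" if "S \<subseteq> ?V" "v \<in> ?V" for S v
    using that by (auto simp: nbrs_def E)
  have sp: "sparse (adj ?G) S \<longleftrightarrow> sparse ?E S" if "S \<subseteq> ?V" for S
    using nb[OF that] that by (auto simp: sparse_def subset_iff)
  have d: "diss_le (adj ?G) ?V (2 * k)"
    using cocktail_path_diss_le[of "2 * s" k] assms(2) sp by (simp add: diss_le_def)
  obtain S where S: "S \<subseteq> ?V" "sparse ?E S" "card S = 2 * k"
    using cocktail_path_sparse_set[OF assms(2), of k] by blast
  have "dissociation_number ?G = 2 * k"
    by (rule dissociation_number_eqI[of _ _ S]) (use V d S sp in auto)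
  moreover have "Digraph_Component.connected (with_proj ?G)"
    unfolding connected_iff_cut[OF pg] V
  proof (intro conjI allI impI)
    show "?V \<noteq> {}" using assms by simp
    fix U assume U: "U \<subseteq> ?V" "U \<noteq> {}" "U \<noteq> ?V"
    show "\<exists>u\<in>U. \<exists>v\<in>?V - U. adj ?G u v"
      using cocktail_path_cut[OF assms(2) U] U(1) unfolding E by blast
  qed
  ultimately show ?thesis using pg V by (simp add: connected_graphs_diss_def)
qed

text \<open>The condition on \<open>s\<close> is what makes the gain of 1 / k^2 in the weights
  outweigh the difference between the denominators \<open>2 * s - 2\<close> and
  \<open>2 * s\<close>.\<close>

lemma cocktail_path_graph_spectral_radius:
  assumes k: "k > 0" and s: "2 * k\<^sup>2 < s"
  shows "graph_spectral_radius (cocktail_path_graph k (2 * s)) < 2 * real s - 2 + 1 / real s"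
proof -
  define n where "n = k * (2 * s)"
  define a where "a i j = (if i < n \<and> j < n \<and> cocktail_path (2 * s) i j then 1 else 0 :: real)" for i j
  have "k\<^sup>2 \<ge> 1" using k by simp
  then have s2: "s \<ge> 2" "real s \<ge> 3" using s by linarith+
  from cocktail_path_weights[OF k s2(1), folded n_def]
  obtain y where y: "\<forall>i<n. y i > 0"
    "\<forall>i<n. (\<Sum>j<n. (if cocktail_path (2 * s) i j then 1 else 0) * y j) \<le>
      (real (2 * s) - 2 + (2 - 1 / real k ^ 2) / (real (2 * s) - 2)) * y i"
    by blast
  have "Max {x. eigenvalue (mat n n (\<lambda>(i, j). a i j)) x} \<le>
      real (2 * s) - 2 + (2 - 1 / real k ^ 2) / (real (2 * s) - 2)"
  proof (rule Max_eigenvalue_le[where y = y])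
    show "n > 0" using k s2 by (simp add: n_def)
    show "a i j = a j i" for i j
      using sgraph_sym[OF sgraph_cocktail_path, of "2 * s" i j] by (simp add: a_def)
    show "(\<Sum>j<n. a i j * y j) \<le> (real (2 * s) - 2 + (2 - 1 / real k ^ 2) / (real (2 * s) - 2)) * y i"
      if "i < n" for i
    proof -
      have "(\<Sum>j<n. a i j * y j) = (\<Sum>j<n. (if cocktail_path (2 * s) i j then 1 else 0) * y j)"
        using that by (intro sum.cong) (auto simp: a_def)
      then show ?thesis using y(2) that by simp
    qed
    show "y i > 0" if "i < n" for i using y(1) that by blast
  qed (simp add: a_def)
  moreover have "mat n n (\<lambda>(i, j). a i j) = adjacency_matrix (cocktail_path_graph k (2 * s))"
    by (auto simp: adjacency_matrix_def cocktail_path_graph_def n_def a_def intro!: eq_matI)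
  moreover have "(2 - 1 / real k ^ 2) / (real (2 * s) - 2) < 1 / real s"
  proof -
    have "real (2 * k\<^sup>2) < real s" using s by (simp only: of_nat_less_iff)
    then have "2 < real s * (1 / real k ^ 2)" using k by (simp add: field_simps)
    then have "(2 - 1 / real k ^ 2) * real s < real (2 * s) - 2" by (simp add: algebra_simps)
    then show ?thesis using s2 by (simp add: divide_less_eq less_divide_eq)
  qed
  ultimately show ?thesis by (simp add: graph_spectral_radius_def)
qed

section \<open>Comparison of the two bounds\<close>

theorem theorem8p3:
  fixes k \<tau> :: nat
  assumes "k > 0" and "\<tau> = 2 * k"
  shows "\<exists>n0::nat. \<forall>n\<ge>n0. \<tau> dvd n \<longrightarrow>
    (\<forall>G. is_arg_min graph_spectral_radius (\<lambda>H. H \<in> connected_graphs_diss n \<tau>) G \<longrightarrow>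
         is_arg_min num_edges (\<lambda>H. H \<in> connected_graphs_diss n \<tau>) G)"
proof -
  obtain N where N: "\<And>(V::nat set) E. sgraph E \<Longrightarrow> finite V \<Longrightarrow> diss_le E V (2 * k) \<Longrightarrow> card V \<ge> N \<Longrightarrow>
    (\<forall>U\<subseteq>V. U \<noteq> {} \<longrightarrow> U \<noteq> V \<longrightarrow> (\<exists>u\<in>U. \<exists>v\<in>V - U. E u v)) \<Longrightarrow>
    real (card V) ^ 2 / k - 2 * card V + 2 * (real k - 1) \<le> arc_count E V"
    using arc_count_connected_ge[OF assms(1)] by metis
  show ?thesis
  \<comment> \<open>From \<open>n > 4 * k ^ 3\<close> and \<open>n = 2 * k * s\<close> follows s > 2
    k^2, the condition for the strict spectral bound of the test graph.\<close>
  proof (intro exI[of _ "max N (Suc (4 * k ^ 3))"] allI impI)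
    fix n G
    assume n: "max N (Suc (4 * k ^ 3)) \<le> n" and "\<tau> dvd n"
      and G: "is_arg_min graph_spectral_radius (\<lambda>H. H \<in> connected_graphs_diss n \<tau>) G"
    from \<open>\<tau> dvd n\<close> obtain s where "n = \<tau> * s" by (rule dvdE)
    then have ns: "n = k * (2 * s)" using assms(2) by simp
    have ks: "2 * k\<^sup>2 < s"
    proof (rule ccontr)
      assume "\<not> ?thesis"
      then have "k * (2 * s) \<le> k * (2 * (2 * k\<^sup>2))" by (intro mult_left_mono) auto
      also have "\<dots> = 4 * k ^ 3" by (simp add: power2_eq_square power3_eq_cube)
      finally show False using n ns by simp
    qed
    have "k\<^sup>2 \<ge> 1" using assms(1) by simp
    then have s2: "s \<ge> 2" "s > 0" using ks by linarith+
    have n0: "n > 0" using n by simp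
    have sq: "real n ^ 2 / k = n * (2 * real s)"
      using assms(1) by (simp add: ns power2_eq_square)
    have lower: "n * (2 * real s) - 2 * n + 2 * (real k - 1) \<le> 2 * real (num_edges H)"
      if H: "H \<in> connected_graphs_diss n \<tau>" for H
    proof -
      have pg: "pair_graph H" "pverts H = {0..<n}" "Digraph_Component.connected (with_proj H)"
        "dissociation_number H = 2 * k"
        using H assms(2) by (auto simp: connected_graphs_diss_def)
      have "real (card (pverts H)) ^ 2 / k - 2 * card (pverts H) + 2 * (real k - 1) \<le>
          arc_count (adj H) (pverts H)"
      proof (rule N)
        show "sgraph (adj H)" "finite (pverts H)" using pg(1) by (simp_all add: pair_graph_iff)
        then show "diss_le (adj H) (pverts H) (2 * k)"
          using diss_le_dissociation_number[of H] pg(4) by simp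
        show "N \<le> card (pverts H)" using n pg(2) by simp
        show "\<forall>U\<subseteq>pverts H. U \<noteq> {} \<longrightarrow> U \<noteq> pverts H \<longrightarrow> (\<exists>u\<in>U. \<exists>v\<in>pverts H - U. adj H u v)"
          using pg(3) unfolding connected_iff_cut[OF pg(1)] by blast
      qed
      moreover have "real (arc_count (adj H) (pverts H)) = 2 * real (num_edges H)"
        using double_num_edges[OF pg(1)] by (metis of_nat_mult of_nat_numeral)
      ultimately show ?thesis using pg(2) sq by simp
    qed
    have GC: "G \<in> connected_graphs_diss n \<tau>" using G by (simp add: is_arg_min_def)
    have upper: "2 * real (num_edges G) < n * (2 * real s) - 2 * n + 2 * real k"
    proof -
      have pg: "pair_graph G" "pverts G = {0..<n}" using GC by (auto simp: connected_graphs_diss_def)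
      have "cocktail_path_graph k (2 * s) \<in> connected_graphs_diss n \<tau>"
        using cocktail_path_graph_mem[OF assms(1) s2(1)] by (simp add: ns assms(2))
      then have "graph_spectral_radius G \<le> graph_spectral_radius (cocktail_path_graph k (2 * s))"
        using G unfolding is_arg_min_def by (meson not_less)
      also have "\<dots> < 2 * real s - 2 + 1 / real s"
        by (rule cocktail_path_graph_spectral_radius[OF assms(1) ks])
      \<comment> \<open>Multiplied by \<open>n = 2 * k * s\<close>, the term \<open>1 / s\<close>
        becomes exactly the \<open>2 * k\<close> arcs of the upper bound.\<close>
      finally have "n * graph_spectral_radius G < n * (2 * real s - 2 + 1 / real s)"
        using n0 by simp
      also have "\<dots> = n * (2 * real s) - 2 * n + 2 * real k"
        using s2 by (simp add: ns algebra_simps)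
      finally show ?thesis
        using spectral_radius_ge_average[OF pg n0] double_num_edges[OF pg(1)] by simp
    qed
    have "num_edges G \<le> num_edges H" if "H \<in> connected_graphs_diss n \<tau>" for H
    proof -
      \<comment> \<open>The right-hand side of \<open>upper\<close> exceeds the left-hand side of
        \<open>lower\<close> by two arcs, so strictness leaves less than one edge.\<close>
      have "real (num_edges G) < real (num_edges H) + 1"
        using lower[OF that] upper by (simp add: algebra_simps)
      then show ?thesis by linarith
    qed
    then show "is_arg_min num_edges (\<lambda>H. H \<in> connected_graphs_diss n \<tau>) G"
      using GC by (auto simp: is_arg_min_def not_less)
  qed
qed

end
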